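(* Consider the system, for $t\ge0$, $x\in[0,1]$, with states $u,p$ (scalar) and $v$ ($\mathbb{R}^n$-valued), and control $U$: $$\partial_t u=-\lambda_1\partial_x u+\sigma_{12}p+\Theta_1 v,\qquad \partial_t v=\Omega_1 u+\Omega_2 p+\Psi v,\qquad \partial_t p=\lambda_2\partial_x p+\sigma_{21}u+\Theta_2 v,$$ $$u(t,0)=U(t)+q\,p(t,0),\qquad p(t,1)=\rho\,u(t,1),$$ and let $U$ be given by the control law $$U(t)=-q\,p(t,0)+\int_0^1K_1(0,\xi)u(t,\xi)d\xi+\int_0^1K_2(0,\xi)p(t,\xi)d\xi+\int_0^1G(0,\xi)v(t,\xi)d\xi .$$ Then the transformation $$\alpha(t,x)=u(t,x)-\int_x^1K_1(x,\xi)u(t,\xi)d\xi-\int_x^1K_2(x,\xi)p(t,\xi)d\xi-\int_x^1G(x,\xi)v(t,\xi)d\xi,$$ $$\beta(t,x)=p(t,x)-\int_x^1Q_1(x,\xi)u(t,\xi)d\xi-\int_x^1Q_2(x,\xi)p(t,\xi)d\xi-\int_x^1R(x,\xi)v(t,\xi)d\xi$$ (with $v$ left unchanged) maps this closed-loop system into the target system $$\partial_t\alpha=-\lambda_1\partial_x\alpha,\qquad \partial_t\beta=\lambda_2\partial_x\beta,$$ $$\partial_t v(t,x)=\Omega_1\alpha(t,x)+\Omega_2\beta(t,x)+\Psi v(t,x)+\int_x^1N_1(x,\xi)\alpha(t,\xi)d\xi+\int_x^1N_2(x,\xi)\beta(t,\xi)d\xi+\int_x^1N_3(x,\xi)v(t,\xi)d\xi,$$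 $$\beta(t,1)=\rho\,\alpha(t,1),\qquad \alpha(t,0)=0,$$ where $N_j(x,\xi)=\Omega_1L_j(x,\xi)+\Omega_2M_j(x,\xi)$ for $j\in\{1,2\}$ and $N_3(x,\xi)=\Omega_1S(x,\xi)+\Omega_2E(x,\xi)$. That is, if $(u,v,p)$ solves the closed-loop system, then $(\alpha,\beta,v)$ solves the target system.
   Context: Setting: $n\ge1$ is an integer; $\lambda_1,\lambda_2>0$; $\rho,q$ are nonzero real numbers; $\sigma_{12},\sigma_{21}\in\mathbb{R}$; $\Theta_1,\Theta_2\in\mathbb{R}^{1\times n}$ (row vectors); $\Omega_1,\Omega_2\in\mathbb{R}^{n}$ (column vectors); $\Psi\in\mathbb{R}^{n\times n}$ is a Hurwitz matrix (standing assumption). Kernels: on the triangle $\mathcal{T}=\{(x,\xi)\in\mathbb{R}^2:0\le x\le\xi\le1\}$, $K_1,K_2,Q_1,Q_2$ (scalar, $\mathcal{C}^1(\mathcal{T})$) and $G,R$ ($\mathbb{R}^{1\times n}$-valued) are the solution of $$\lambda_1\partial_xK_1+\lambda_1\partial_\xi K_1=-\sigma_{21}K_2-G\Omega_1,\qquad \lambda_1\partial_xK_2-\lambda_2\partial_\xi K_2=-\sigma_{12}K_1-G\Omega_2,$$ $$\lambda_1\partial_xG=-K_1\Theta_1-K_2\Theta_2-G\Psi,$$ $$\lambda_2\partial_xQ_1-\lambda_1\partial_\xi Q_1=\sigma_{21}Q_2+R\Omega_1,\qquad \lambda_2\partial_xQ_2+\lambda_2\partial_\xi Q_2=\sigma_{12}Q_1+R\Omega_2,$$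 $$\lambda_2\partial_xR=Q_1\Theta_1+Q_2\Theta_2+R\Psi,$$ with boundary conditions $$K_1(x,1)=\frac{\lambda_2\rho}{\lambda_1}K_2(x,1),\quad K_2(x,x)=-\frac{\sigma_{12}}{\lambda_1+\lambda_2},\quad G(x,x)=-\frac{\Theta_1}{\lambda_1},$$ $$Q_1(x,x)=\frac{\sigma_{21}}{\lambda_1+\lambda_2},\quad Q_2(x,1)=\frac{\lambda_1}{\lambda_2\rho}Q_1(x,1),\quad R(x,x)=\frac{\Theta_2}{\lambda_2}.$$ Inverse kernels: $L_1,L_2,M_1,M_2$ (scalar) and $S,E$ ($\mathbb{R}^{1\times n}$-valued), defined on $\mathcal{T}$, are the kernels of the inverse of the Volterra transformation $(u,p,v)\mapsto(\alpha,\beta,v)$, i.e. $$u(t,x)=\alpha(t,x)+\int_x^1L_1(x,\xi)\alpha(t,\xi)d\xi+\int_x^1L_2(x,\xi)\beta(t,\xi)d\xi+\int_x^1S(x,\xi)v(t,\xi)d\xi,$$ $$p(t,x)=\beta(t,x)+\int_x^1M_1(x,\xi)\alpha(t,\xi)d\xi+\int_x^1M_2(x,\xi)\beta(t,\xi)d\xi+\int_x^1E(x,\xi)v(t,\xi)d\xi.$$ The inverse transformation always exists, by the theory of Volterra integral equations. *)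

theory Defs
  imports "HOL-Analysis.Analysis"
begin

text \<open>
  Column vectors in $n$-space and row vectors are both elements of \<open>real ^ 'n\<close>, with
  \<open>CARD('n)\<close> in the role of $n$.  For a row \<open>g\<close>, a column \<open>w\<close> and a matrix \<open>A\<close>, the row-column
  product is \<open>g \<bullet> w\<close>, the row-matrix product is \<open>g v* A\<close>, and the column-row product is
  the matrix \<open>outer w g\<close>.
\<close>

definition outer :: "real ^ 'n \<Rightarrow> real ^ 'n \<Rightarrow> real ^ 'n ^ 'n" where
  "outer w g = (\<chi> i j. w $ i * g $ j)"

definition hurwitz :: "real ^ 'n ^ 'n \<Rightarrow> bool" where
  "hurwitz A \<longleftrightarrow>
     (\<forall>(c::complex) (w::complex ^ 'n).
        w \<noteq> 0 \<and> (\<chi> i j. complex_of_real (A $ i $ j)) *v w = c *s w \<longrightarrow> Re c < 0)"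

definition tri :: "(real \<times> real) set" where
  "tri = {(x, \<xi>). 0 \<le> x \<and> x \<le> \<xi> \<and> \<xi> \<le> 1}"

definition time_space :: "(real \<times> real) set" where
  "time_space = {0..} \<times> {0..1}"

text \<open>
  \<open>C1_partials D f f1 f2\<close>: \<open>f\<close> is continuously differentiable on \<open>D\<close> up to the boundary, with
  partial derivatives \<open>f1\<close>, \<open>f2\<close>.  The derivative is the total derivative within \<open>D\<close>, because
  the triangle has degenerate coordinate sections at its corners, on which a one-variable
  derivative would be meaningless.
\<close>

definition C1_partials ::
  "(real \<times> real) set \<Rightarrow> (real \<Rightarrow> real \<Rightarrow> real) \<Rightarrow> (real \<Rightarrow> real \<Rightarrow> real) \<Rightarrow> (real \<Rightarrow> real \<Rightarrow> real) \<Rightarrow> bool"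
  where
  "C1_partials D f f1 f2 \<longleftrightarrow>
     continuous_on D (\<lambda>(a, b). f1 a b) \<and> continuous_on D (\<lambda>(a, b). f2 a b) \<and>
     (\<forall>a b. (a, b) \<in> D \<longrightarrow>
        ((\<lambda>(a, b). f a b) has_derivative (\<lambda>(h, k). f1 a b * h + f2 a b * k)) (at (a, b) within D))"

definition volterra ::
  "(real \<Rightarrow> real \<Rightarrow> real) \<Rightarrow> (real \<Rightarrow> real \<Rightarrow> real) \<Rightarrow> (real \<Rightarrow> real \<Rightarrow> real ^ 'n) \<Rightarrow>
   (real \<Rightarrow> real) \<Rightarrow> (real \<Rightarrow> real) \<Rightarrow> (real \<Rightarrow> real ^ 'n) \<Rightarrow> real \<Rightarrow> real" where
  "volterra A B C f g w x =
     integral {x..1} (\<lambda>\<xi>. A x \<xi> * f \<xi>) + integral {x..1} (\<lambda>\<xi>. B x \<xi> * g \<xi>)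
       + integral {x..1} (\<lambda>\<xi>. C x \<xi> \<bullet> w \<xi>)"

text \<open>
  The two kernel systems.  In the equations for the row-valued kernels \<open>G\<close> and \<open>R\<close> only
  the derivative in \<open>x\<close> occurs; it is taken along the section \<open>{0..\<xi>}\<close> of the triangle.
\<close>

definition K_kernels ::
  "real \<Rightarrow> real \<Rightarrow> real \<Rightarrow> real \<Rightarrow> real \<Rightarrow> real ^ 'n \<Rightarrow> real ^ 'n \<Rightarrow> real ^ 'n \<Rightarrow> real ^ 'n \<Rightarrow>
   real ^ 'n ^ 'n \<Rightarrow> (real \<Rightarrow> real \<Rightarrow> real) \<Rightarrow> (real \<Rightarrow> real \<Rightarrow> real) \<Rightarrow> (real \<Rightarrow> real \<Rightarrow> real ^ 'n) \<Rightarrow> bool"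
  where
  "K_kernels lam1 lam2 \<rho> \<sigma>12 \<sigma>21 \<Theta>1 \<Theta>2 \<Omega>1 \<Omega>2 \<Psi> K1 K2 G \<longleftrightarrow>
     (\<exists>K1x K1\<xi> K2x K2\<xi> Gx.
        C1_partials tri K1 K1x K1\<xi> \<and> C1_partials tri K2 K2x K2\<xi> \<and>
        (\<forall>x \<xi>. (x, \<xi>) \<in> tri \<longrightarrow>
           ((\<lambda>y. G y \<xi>) has_vector_derivative Gx x \<xi>) (at x within {0..\<xi>}) \<and>
           lam1 * K1x x \<xi> + lam1 * K1\<xi> x \<xi> = - \<sigma>21 * K2 x \<xi> - G x \<xi> \<bullet> \<Omega>1 \<and>
           lam1 * K2x x \<xi> - lam2 * K2\<xi> x \<xi> = - \<sigma>12 * K1 x \<xi> - G x \<xi> \<bullet> \<Omega>2 \<and>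
           lam1 *\<^sub>R Gx x \<xi> = - (K1 x \<xi> *\<^sub>R \<Theta>1) - K2 x \<xi> *\<^sub>R \<Theta>2 - G x \<xi> v* \<Psi>)) \<and>
     (\<forall>x\<in>{0..1}.
        K1 x 1 = lam2 * \<rho> / lam1 * K2 x 1 \<and>
        K2 x x = - \<sigma>12 / (lam1 + lam2) \<and>
        G x x = - ((1 / lam1) *\<^sub>R \<Theta>1))"

definition Q_kernels ::
  "real \<Rightarrow> real \<Rightarrow> real \<Rightarrow> real \<Rightarrow> real \<Rightarrow> real ^ 'n \<Rightarrow> real ^ 'n \<Rightarrow> real ^ 'n \<Rightarrow> real ^ 'n \<Rightarrow>
   real ^ 'n ^ 'n \<Rightarrow> (real \<Rightarrow> real \<Rightarrow> real) \<Rightarrow> (real \<Rightarrow> real \<Rightarrow> real) \<Rightarrow> (real \<Rightarrow> real \<Rightarrow> real ^ 'n) \<Rightarrow> bool"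
  where
  "Q_kernels lam1 lam2 \<rho> \<sigma>12 \<sigma>21 \<Theta>1 \<Theta>2 \<Omega>1 \<Omega>2 \<Psi> Q1 Q2 R \<longleftrightarrow>
     (\<exists>Q1x Q1\<xi> Q2x Q2\<xi> Rx.
        C1_partials tri Q1 Q1x Q1\<xi> \<and> C1_partials tri Q2 Q2x Q2\<xi> \<and>
        (\<forall>x \<xi>. (x, \<xi>) \<in> tri \<longrightarrow>
           ((\<lambda>y. R y \<xi>) has_vector_derivative Rx x \<xi>) (at x within {0..\<xi>}) \<and>
           lam2 * Q1x x \<xi> - lam1 * Q1\<xi> x \<xi> = \<sigma>21 * Q2 x \<xi> + R x \<xi> \<bullet> \<Omega>1 \<and>
           lam2 * Q2x x \<xi> + lam2 * Q2\<xi> x \<xi> = \<sigma>12 * Q1 x \<xi> + R x \<xi> \<bullet> \<Omega>2 \<and>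
           lam2 *\<^sub>R Rx x \<xi> = Q1 x \<xi> *\<^sub>R \<Theta>1 + Q2 x \<xi> *\<^sub>R \<Theta>2 + R x \<xi> v* \<Psi>)) \<and>
     (\<forall>x\<in>{0..1}.
        Q1 x x = \<sigma>21 / (lam1 + lam2) \<and>
        Q2 x 1 = lam1 / (lam2 * \<rho>) * Q1 x 1 \<and>
        R x x = (1 / lam2) *\<^sub>R \<Theta>2)"

text \<open>
  The forward transformation acts on the profiles \<open>u, p, v\<close> of \<open>x\<close> at a frozen time and keeps
  \<open>v\<close>.  Its inverse is again of Volterra type; the predicate says that \<open>L1, L2, S, M1, M2, E\<close>
  are continuous kernels representing it on continuous profiles.  As the forward map is a
  bijection of the continuous profiles, inverting it from the left is enough.
\<close>

definition inverse_kernels ::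
  "(real \<Rightarrow> real \<Rightarrow> real) \<Rightarrow> (real \<Rightarrow> real \<Rightarrow> real) \<Rightarrow> (real \<Rightarrow> real \<Rightarrow> real ^ 'n) \<Rightarrow>
   (real \<Rightarrow> real \<Rightarrow> real) \<Rightarrow> (real \<Rightarrow> real \<Rightarrow> real) \<Rightarrow> (real \<Rightarrow> real \<Rightarrow> real ^ 'n) \<Rightarrow>
   (real \<Rightarrow> real \<Rightarrow> real) \<Rightarrow> (real \<Rightarrow> real \<Rightarrow> real) \<Rightarrow> (real \<Rightarrow> real \<Rightarrow> real ^ 'n) \<Rightarrow>
   (real \<Rightarrow> real \<Rightarrow> real) \<Rightarrow> (real \<Rightarrow> real \<Rightarrow> real) \<Rightarrow> (real \<Rightarrow> real \<Rightarrow> real ^ 'n) \<Rightarrow> bool" where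
  "inverse_kernels K1 K2 G Q1 Q2 R L1 L2 S M1 M2 E \<longleftrightarrow>
     continuous_on tri (\<lambda>(x, \<xi>). L1 x \<xi>) \<and> continuous_on tri (\<lambda>(x, \<xi>). L2 x \<xi>) \<and>
     continuous_on tri (\<lambda>(x, \<xi>). S x \<xi>) \<and>
     continuous_on tri (\<lambda>(x, \<xi>). M1 x \<xi>) \<and> continuous_on tri (\<lambda>(x, \<xi>). M2 x \<xi>) \<and>
     continuous_on tri (\<lambda>(x, \<xi>). E x \<xi>) \<and>
     (\<forall>u p v \<alpha> \<beta>.
        continuous_on {0..1} u \<and> continuous_on {0..1} p \<and> continuous_on {0..1} v \<and>
        (\<forall>x\<in>{0..1}. \<alpha> x = u x - volterra K1 K2 G u p v x \<and>
                    \<beta> x = p x - volterra Q1 Q2 R u p v x) \<longrightarrow>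
        (\<forall>x\<in>{0..1}. u x = \<alpha> x + volterra L1 L2 S \<alpha> \<beta> v x \<and>
                    p x = \<beta> x + volterra M1 M2 E \<alpha> \<beta> v x))"

text \<open>
  Solutions are classical: the two transported states are continuously differentiable on
  \<open>{0..} \<times> {0..1}\<close>, and \<open>v\<close> is jointly continuous and differentiable in time (one-sided at
  time 0).  No derivative of \<open>v\<close> in \<open>x\<close> occurs in the equations, and none is required.
\<close>

definition plant_solution ::
  "real \<Rightarrow> real \<Rightarrow> real \<Rightarrow> real \<Rightarrow> real \<Rightarrow> real \<Rightarrow> real ^ 'n \<Rightarrow> real ^ 'n \<Rightarrow> real ^ 'n \<Rightarrow> real ^ 'n \<Rightarrow>
   real ^ 'n ^ 'n \<Rightarrow> (real \<Rightarrow> real) \<Rightarrow>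
   (real \<Rightarrow> real \<Rightarrow> real) \<Rightarrow> (real \<Rightarrow> real \<Rightarrow> real) \<Rightarrow> (real \<Rightarrow> real \<Rightarrow> real ^ 'n) \<Rightarrow> bool" where
  "plant_solution lam1 lam2 \<rho> q \<sigma>12 \<sigma>21 \<Theta>1 \<Theta>2 \<Omega>1 \<Omega>2 \<Psi> U u p v \<longleftrightarrow>
     continuous_on time_space (\<lambda>(t, x). v t x) \<and>
     (\<exists>ut ux pt px.
        C1_partials time_space u ut ux \<and> C1_partials time_space p pt px \<and>
        (\<forall>t\<ge>0. \<forall>x\<in>{0..1}.
           ut t x = - lam1 * ux t x + \<sigma>12 * p t x + \<Theta>1 \<bullet> v t x \<and>
           ((\<lambda>s. v s x) has_vector_derivative
              (u t x *\<^sub>R \<Omega>1 + p t x *\<^sub>R \<Omega>2 + \<Psi> *v v t x)) (at t within {0..}) \<and>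
           pt t x = lam2 * px t x + \<sigma>21 * u t x + \<Theta>2 \<bullet> v t x)) \<and>
     (\<forall>t\<ge>0. u t 0 = U t + q * p t 0 \<and> p t 1 = \<rho> * u t 1)"

definition target_solution ::
  "real \<Rightarrow> real \<Rightarrow> real \<Rightarrow> real ^ 'n \<Rightarrow> real ^ 'n \<Rightarrow> real ^ 'n ^ 'n \<Rightarrow>
   (real \<Rightarrow> real \<Rightarrow> real ^ 'n) \<Rightarrow> (real \<Rightarrow> real \<Rightarrow> real ^ 'n) \<Rightarrow> (real \<Rightarrow> real \<Rightarrow> real ^ 'n ^ 'n) \<Rightarrow>
   (real \<Rightarrow> real \<Rightarrow> real) \<Rightarrow> (real \<Rightarrow> real \<Rightarrow> real) \<Rightarrow> (real \<Rightarrow> real \<Rightarrow> real ^ 'n) \<Rightarrow> bool" where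
  "target_solution lam1 lam2 \<rho> \<Omega>1 \<Omega>2 \<Psi> N1 N2 N3 \<alpha> \<beta> v \<longleftrightarrow>
     continuous_on time_space (\<lambda>(t, x). v t x) \<and>
     (\<exists>\<alpha>t \<alpha>x \<beta>t \<beta>x.
        C1_partials time_space \<alpha> \<alpha>t \<alpha>x \<and> C1_partials time_space \<beta> \<beta>t \<beta>x \<and>
        (\<forall>t\<ge>0. \<forall>x\<in>{0..1}.
           \<alpha>t t x = - lam1 * \<alpha>x t x \<and>
           \<beta>t t x = lam2 * \<beta>x t x \<and>
           ((\<lambda>s. v s x) has_vector_derivative
              (\<alpha> t x *\<^sub>R \<Omega>1 + \<beta> t x *\<^sub>R \<Omega>2 + \<Psi> *v v t x
               + integral {x..1} (\<lambda>\<xi>. \<alpha> t \<xi> *\<^sub>R N1 x \<xi>)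
               + integral {x..1} (\<lambda>\<xi>. \<beta> t \<xi> *\<^sub>R N2 x \<xi>)
               + integral {x..1} (\<lambda>\<xi>. N3 x \<xi> *v v t \<xi>))) (at t within {0..}))) \<and>
     (\<forall>t\<ge>0. \<beta> t 1 = \<rho> * \<alpha> t 1 \<and> \<alpha> t 0 = 0)"

end

theory Submission
  imports Defs
begin

text \<open>
  Write \<open>T\<close> for the Volterra part of one of the two transformed states, say \<open>\<alpha> = u - T\<close>.  The claim
  \<open>\<alpha>t + lam1 * \<alpha>x = 0\<close> says that \<open>Tt + lam1 * Tx\<close> equals the coupling terms \<open>\<sigma>12 * p + \<Theta>1 \<bullet> v\<close>
  of the plant.  Inserting the plant equations into \<open>Tt\<close> and integrating by parts moves the
  space derivatives of \<open>u\<close> and \<open>p\<close> to the kernels.  The kernel equations make the remaining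
  integrand vanish, the condition on the kernels at \<open>\<xi> = 1\<close> and \<open>p = \<rho> * u\<close> cancel the
  boundary terms there, and the prescribed diagonal values turn the terms at \<open>\<xi> = x\<close> into the
  coupling terms.  The state \<open>\<beta>\<close>
  obeys the same computation with \<open>lam1\<close> replaced by \<open>- lam2\<close>, so both follow from the
  lemma \<open>volterra_transport_identity\<close>.  The control law is \<open>\<alpha> = 0\<close> at \<open>x = 0\<close>, and the
  equation for \<open>v\<close> arises by substituting the inverse transformation for \<open>u\<close> and \<open>p\<close>.

  The analytic work lies in the regularity of \<open>\<alpha>\<close> and \<open>\<beta>\<close>.  Volterra integrals of
  differentiable states are continuously differentiable in time and space
  (\<open>C1_partials_volterra_integral\<close>), provided the kernel and its \<open>x\<close>-derivative are jointly continuous on the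
  triangle.  For the vector kernels only a differential equation in \<open>x\<close> for each fixed \<open>\<xi>\<close> is
  given; their joint continuity is a consequence of the constant value on the diagonal and a Gronwall
  estimate (\<open>continuous_on_tri_of_section_ode\<close>).
\<close>

section \<open>Functions with continuous partial derivatives\<close>

lemma C1_partials_imp_continuous_on:
  assumes "C1_partials D f f1 f2"
  shows "continuous_on D (\<lambda>(a, b). f a b)"
  using assms unfolding C1_partials_def continuous_on_eq_continuous_within
  by (auto intro!: has_derivative_continuous)

lemma C1_partials_fst_section:
  assumes "C1_partials D f f1 f2" "(a, b) \<in> D" "\<And>y. y \<in> X \<Longrightarrow> (y, b) \<in> D"
  shows "((\<lambda>y. f y b) has_vector_derivative f1 a b) (at a within X)"
proof -
  have "((\<lambda>(a, b). f a b) has_derivative (\<lambda>(h, k). f1 a b * h + f2 a b * k)) (at (a, b) within D)"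
    using assms unfolding C1_partials_def by blast
  then have "((\<lambda>(a, b). f a b) has_derivative (\<lambda>(h, k). f1 a b * h + f2 a b * k))
      (at (a, b) within (\<lambda>y. (y, b)) ` X)"
    by (rule has_derivative_subset) (use assms in auto)
  moreover have "((\<lambda>y. (y, b)) has_derivative (\<lambda>h. (h, 0))) (at a within X)"
    by (auto intro!: derivative_eq_intros)
  ultimately show ?thesis
    using diff_chain_within[of "\<lambda>y. (y, b)" "\<lambda>h. (h, 0)" a X]
    by (fastforce simp: has_vector_derivative_def o_def mult.commute)
qed

lemma C1_partials_snd_section:
  assumes "C1_partials D f f1 f2" "(a, b) \<in> D" "\<And>y. y \<in> X \<Longrightarrow> (a, y) \<in> D"
  shows "((\<lambda>y. f a y) has_vector_derivative f2 a b) (at b within X)"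
proof -
  have "((\<lambda>(a, b). f a b) has_derivative (\<lambda>(h, k). f1 a b * h + f2 a b * k)) (at (a, b) within D)"
    using assms unfolding C1_partials_def by blast
  then have "((\<lambda>(a, b). f a b) has_derivative (\<lambda>(h, k). f1 a b * h + f2 a b * k))
      (at (a, b) within (\<lambda>y. (a, y)) ` X)"
    by (rule has_derivative_subset) (use assms in auto)
  moreover have "((\<lambda>y. (a, y)) has_derivative (\<lambda>h. (0, h))) (at b within X)"
    by (auto intro!: derivative_eq_intros)
  ultimately show ?thesis
    using diff_chain_within[of "\<lambda>y. (a, y)" "\<lambda>h. (0, h)" b X]
    by (fastforce simp: has_vector_derivative_def o_def mult.commute)
qed

lemma C1_partials_add:
  assumes "C1_partials D f f1 f2" "C1_partials D g g1 g2"
  shows "C1_partials D (\<lambda>a b. f a b + g a b) (\<lambda>a b. f1 a b + g1 a b) (\<lambda>a b. f2 a b + g2 a b)"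
  unfolding C1_partials_def
proof (intro conjI allI impI)
  show "continuous_on D (\<lambda>(a, b). f1 a b + g1 a b)" "continuous_on D (\<lambda>(a, b). f2 a b + g2 a b)"
    using assms unfolding C1_partials_def by (auto intro: continuous_on_add simp: split_beta)
  fix a b assume "(a, b) \<in> D"
  then have "((\<lambda>(a, b). f a b) has_derivative (\<lambda>(h, k). f1 a b * h + f2 a b * k)) (at (a, b) within D)"
    "((\<lambda>(a, b). g a b) has_derivative (\<lambda>(h, k). g1 a b * h + g2 a b * k)) (at (a, b) within D)"
    using assms unfolding C1_partials_def by blast+
  from has_derivative_add[OF this]
  show "((\<lambda>(a, b). f a b + g a b) has_derivative
      (\<lambda>(h, k). (f1 a b + g1 a b) * h + (f2 a b + g2 a b) * k)) (at (a, b) within D)"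
    by (simp add: case_prod_unfold algebra_simps)
qed

lemma C1_partials_diff:
  assumes "C1_partials D f f1 f2" "C1_partials D g g1 g2"
  shows "C1_partials D (\<lambda>a b. f a b - g a b) (\<lambda>a b. f1 a b - g1 a b) (\<lambda>a b. f2 a b - g2 a b)"
  unfolding C1_partials_def
proof (intro conjI allI impI)
  show "continuous_on D (\<lambda>(a, b). f1 a b - g1 a b)" "continuous_on D (\<lambda>(a, b). f2 a b - g2 a b)"
    using assms unfolding C1_partials_def by (auto intro: continuous_on_diff simp: split_beta)
  fix a b assume "(a, b) \<in> D"
  then have "((\<lambda>(a, b). f a b) has_derivative (\<lambda>(h, k). f1 a b * h + f2 a b * k)) (at (a, b) within D)"
    "((\<lambda>(a, b). g a b) has_derivative (\<lambda>(h, k). g1 a b * h + g2 a b * k)) (at (a, b) within D)"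
    using assms unfolding C1_partials_def by blast+
  from has_derivative_diff[OF this]
  show "((\<lambda>(a, b). f a b - g a b) has_derivative
      (\<lambda>(h, k). (f1 a b - g1 a b) * h + (f2 a b - g2 a b) * k)) (at (a, b) within D)"
    by (simp add: case_prod_unfold algebra_simps)
qed

lemma C1_partials_transform:
  assumes "C1_partials D f f1 f2" "\<And>a b. (a, b) \<in> D \<Longrightarrow> g a b = f a b"
  shows "C1_partials D g f1 f2"
  unfolding C1_partials_def
proof (intro conjI allI impI)
  fix a b assume ab: "(a, b) \<in> D"
  then have "((\<lambda>(a, b). f a b) has_derivative (\<lambda>(h, k). f1 a b * h + f2 a b * k)) (at (a, b) within D)"
    using assms(1) unfolding C1_partials_def by blast
  from has_derivative_transform[OF ab _ this]
  show "((\<lambda>(a, b). g a b) has_derivative (\<lambda>(h, k). f1 a b * h + f2 a b * k)) (at (a, b) within D)"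
    using assms(2) by (simp add: case_prod_unfold)
qed (use assms(1) in \<open>auto simp: C1_partials_def\<close>)

text \<open>
  Only the second partial derivative has to be continuous, and the first may be known at the one
  point.  This asymmetry matters below, where the first partial derivative is an integral.
\<close>

lemma has_derivative_rectangle:
  fixes f :: "real \<Rightarrow> real \<Rightarrow> real"
  assumes "convex Y" "a \<in> X" "b \<in> Y"
    and f2: "continuous_on (X \<times> Y) (\<lambda>(a, b). f2 a b)"
    and d1: "((\<lambda>y. f y b) has_vector_derivative c) (at a within X)"
    and d2: "\<And>a b. a \<in> X \<Longrightarrow> b \<in> Y \<Longrightarrow> ((\<lambda>y. f a y) has_vector_derivative f2 a b) (at b within Y)"
  shows "((\<lambda>(a, b). f a b) has_derivative (\<lambda>(h, k). c * h + f2 a b * k)) (at (a, b) within X \<times> Y)"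
proof -
  have "continuous (at (a, b) within X \<times> Y) (\<lambda>(a, b). f2 a b)"
    using f2 assms(2,3) unfolding continuous_on_eq_continuous_within by blast
  then have "continuous (at (a, b) within X \<times> Y) (\<lambda>(a, b). blinfun_mult_right (f2 a b))"
    unfolding case_prod_unfold
    by (rule bounded_linear.continuous[OF bounded_linear_blinfun_mult_right])
  then have "((\<lambda>(a, b). f a b) has_derivative
      (\<lambda>(h, k). c * h + blinfun_apply (blinfun_mult_right (f2 a b)) k)) (at (a, b) within X \<times> Y)"
    using assms(1-3) d1 d2
    by (intro has_derivative_partialsI[where fx = "\<lambda>h. c * h"])
      (simp_all add: has_vector_derivative_def mult.commute[of _ c] mult_commute_abs)
  then show ?thesis
    by simp
qed

lemma C1_partials_rectangleI:
  assumes "convex Y"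
    and f1: "continuous_on (X \<times> Y) (\<lambda>(a, b). f1 a b)" and f2: "continuous_on (X \<times> Y) (\<lambda>(a, b). f2 a b)"
    and d1: "\<And>a b. a \<in> X \<Longrightarrow> b \<in> Y \<Longrightarrow> ((\<lambda>y. f y b) has_vector_derivative f1 a b) (at a within X)"
    and d2: "\<And>a b. a \<in> X \<Longrightarrow> b \<in> Y \<Longrightarrow> ((\<lambda>y. f a y) has_vector_derivative f2 a b) (at b within Y)"
  shows "C1_partials (X \<times> Y) f f1 f2"
  unfolding C1_partials_def using assms by (auto intro!: has_derivative_rectangle)

section \<open>Volterra integrals\<close>

text \<open>
  Moving to a fixed interval turns the dependence of \<open>integral {x..1}\<close> on its lower limit into a
  dependence of the integrand, so that continuity in parameters needs no extension of the kernel.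
\<close>

lemma integral_rescale_to_unit_interval:
  fixes h :: "real \<Rightarrow> real"
  assumes "continuous_on {x..1} h" "x \<le> 1"
  shows "integral {x..1} h = (1 - x) * integral {0..1} (\<lambda>s. h (x + s * (1 - x)))"
proof -
  have "((\<lambda>s. (1 - x) *\<^sub>R h (x + s * (1 - x))) has_integral
      integral {x + 0 * (1 - x)..x + 1 * (1 - x)} h) {0..1}"
  proof (rule has_integral_substitution[where c = x and d = 1])
    show "(\<lambda>s. x + s * (1 - x)) ` {0..1} \<subseteq> {x..1}"
    proof (rule image_subsetI)
      fix s :: real assume "s \<in> {0..1}"
      then show "x + s * (1 - x) \<in> {x..1}"
        using assms(2) mult_right_mono[of s 1 "1 - x"] by auto
    qed
  qed (use assms in \<open>auto intro!: derivative_eq_intros\<close>)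
  from integral_unique[OF this] show ?thesis
    by simp
qed

lemma continuous_on_compose_pair:
  assumes "continuous_on D (\<lambda>(a, b). f a b)" "continuous_on S g" "continuous_on S h"
    "\<And>z. z \<in> S \<Longrightarrow> (g z, h z) \<in> D"
  shows "continuous_on S (\<lambda>z. f (g z) (h z))"
  using continuous_on_compose2[OF assms(1) continuous_on_Pair[OF assms(2,3)]] assms(4) by auto

lemma continuous_on_volterra_integral:
  fixes A f :: "real \<Rightarrow> real \<Rightarrow> 'a::euclidean_space"
  assumes A: "continuous_on tri (\<lambda>(x, \<xi>). A x \<xi>)"
    and f: "continuous_on time_space (\<lambda>(t, x). f t x)"
  shows "continuous_on time_space (\<lambda>(t, x). integral {x..1} (\<lambda>\<xi>. A x \<xi> \<bullet> f t \<xi>))"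
proof -
  define r where "r x s = x + s * (1 - x)" for x s :: real
  have r: "x \<le> r x s" "r x s \<le> 1" if "0 \<le> x" "x \<le> 1" "0 \<le> s" "s \<le> 1" for x s
    using that mult_right_mono[of s 1 "1 - x"] unfolding r_def by auto
  have rc: "continuous_on (time_space \<times> cbox 0 1) (\<lambda>w. r (snd (fst w)) (snd w))"
    unfolding r_def by (intro continuous_intros)
  have "continuous_on (time_space \<times> cbox 0 1) (\<lambda>w. A (snd (fst w)) (r (snd (fst w)) (snd w)))"
    by (rule continuous_on_compose_pair[OF A _ rc])
      (auto intro!: continuous_intros r simp: tri_def time_space_def)
  moreover have "continuous_on (time_space \<times> cbox 0 1) (\<lambda>w. f (fst (fst w)) (r (snd (fst w)) (snd w)))"
    by (rule continuous_on_compose_pair[OF f _ rc])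
      (auto intro!: continuous_intros r order_trans[OF _ r(1)] simp: time_space_def)
  ultimately have "continuous_on (time_space \<times> cbox 0 1)
      (\<lambda>(z, s). A (snd z) (r (snd z) s) \<bullet> f (fst z) (r (snd z) s))"
    unfolding case_prod_unfold by (rule continuous_on_inner)
  then have "continuous_on time_space
      (\<lambda>z. integral (cbox 0 1) (\<lambda>s. A (snd z) (r (snd z) s) \<bullet> f (fst z) (r (snd z) s)))"
    by (rule integral_continuous_on_param)
  then have "continuous_on time_space (\<lambda>z. (1 - snd z) *
      integral {0..1} (\<lambda>s. A (snd z) (r (snd z) s) \<bullet> f (fst z) (r (snd z) s)))"
    by (auto intro!: continuous_intros)
  moreover have "(1 - x) * integral {0..1} (\<lambda>s. A x (r x s) \<bullet> f t (r x s))
      = integral {x..1} (\<lambda>\<xi>. A x \<xi> \<bullet> f t \<xi>)" if "(t, x) \<in> time_space" for t x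
    unfolding r_def using that
    by (intro integral_rescale_to_unit_interval[symmetric] continuous_on_inner
        continuous_on_compose_pair[OF A] continuous_on_compose_pair[OF f] continuous_intros)
      (auto simp: time_space_def tri_def)
  ultimately show ?thesis
    by (auto elim!: continuous_on_eq)
qed

text \<open>
  The section \<open>{0..\<xi>}\<close> on which a kernel can be differentiated ends at the diagonal, which
  prevents differentiation under the integral sign at the lower limit.  Continuing each section
  affinely beyond \<open>\<xi>\<close>, with the slope it has there, gives a kernel on the whole square with a
  continuous \<open>x\<close>-derivative.  The construction stays within
  each section and so applies to the vector kernels, whose equations contain \<open>x\<close>-derivatives alone.
\<close>

lemma extend_kernel_past_diagonal:
  fixes A Ax :: "real \<Rightarrow> real \<Rightarrow> 'a::real_normed_vector"
  assumes A: "continuous_on tri (\<lambda>(x, \<xi>). A x \<xi>)" and Ax: "continuous_on tri (\<lambda>(x, \<xi>). Ax x \<xi>)"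
    and dA: "\<And>x \<xi>. (x, \<xi>) \<in> tri \<Longrightarrow>
      ((\<lambda>y. A y \<xi>) has_vector_derivative Ax x \<xi>) (at x within {0..\<xi>})"
  obtains B Bx where
    "continuous_on ({0..1} \<times> {0..1}) (\<lambda>(x, \<xi>). B x \<xi>)"
    "continuous_on ({0..1} \<times> {0..1}) (\<lambda>(x, \<xi>). Bx x \<xi>)"
    "\<And>x \<xi>. x \<in> {0..1} \<Longrightarrow> \<xi> \<in> {0..1} \<Longrightarrow>
      ((\<lambda>y. B y \<xi>) has_vector_derivative Bx x \<xi>) (at x within {0..1})"
    "\<And>x \<xi>. (x, \<xi>) \<in> tri \<Longrightarrow> B x \<xi> = A x \<xi>"
    "\<And>x \<xi>. (x, \<xi>) \<in> tri \<Longrightarrow> Bx x \<xi> = Ax x \<xi>"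
proof
  define B where "B x \<xi> = A (min x \<xi>) \<xi> + (x - min x \<xi>) *\<^sub>R Ax \<xi> \<xi>" for x \<xi>
  define Bx where "Bx x \<xi> = Ax (min x \<xi>) \<xi>" for x \<xi>
  show "continuous_on ({0..1} \<times> {0..1}) (\<lambda>(x, \<xi>). B x \<xi>)"
    "continuous_on ({0..1} \<times> {0..1}) (\<lambda>(x, \<xi>). Bx x \<xi>)"
    unfolding B_def Bx_def case_prod_unfold
    by (intro continuous_intros continuous_on_compose_pair[OF A] continuous_on_compose_pair[OF Ax];
        force simp: tri_def)+
  show "B x \<xi> = A x \<xi>" "Bx x \<xi> = Ax x \<xi>" if "(x, \<xi>) \<in> tri" for x \<xi>
    using that by (auto simp: B_def Bx_def tri_def min_def)
  fix x \<xi> :: real assume x: "x \<in> {0..1}" and \<xi>: "\<xi> \<in> {0..1}"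
  have "((\<lambda>y. if y \<in> {0..\<xi>} then A y \<xi> else A \<xi> \<xi> + (y - \<xi>) *\<^sub>R Ax \<xi> \<xi>) has_vector_derivative
      (if x \<in> {0..\<xi>} then Ax x \<xi> else Ax \<xi> \<xi>)) (at x within {0..1})"
  proof (rule has_vector_derivative_If_within_closures[where T = "{\<xi>..1}"])
    show "((\<lambda>y. A y \<xi>) has_vector_derivative Ax x \<xi>)
        (at x within {0..\<xi>} \<union> (closure {0..\<xi>} \<inter> closure {\<xi>..1}))"
      if "x \<in> {0..\<xi>} \<union> (closure {0..\<xi>} \<inter> closure {\<xi>..1})"
    proof -
      have "{0..\<xi>} \<union> (closure {0..\<xi>} \<inter> closure {\<xi>..1}) = {0..\<xi>}" by auto
      then show ?thesis using dA[of x \<xi>] \<xi> that by (auto simp: tri_def)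
    qed
    show "((\<lambda>y. A \<xi> \<xi> + (y - \<xi>) *\<^sub>R Ax \<xi> \<xi>) has_vector_derivative Ax \<xi> \<xi>)
        (at x within {\<xi>..1} \<union> (closure {0..\<xi>} \<inter> closure {\<xi>..1}))"
      by (auto intro!: derivative_eq_intros)
  qed (use x \<xi> in auto)
  moreover have "(if x \<in> {0..\<xi>} then Ax x \<xi> else Ax \<xi> \<xi>) = Bx x \<xi>"
    using x by (auto simp: Bx_def min_def)
  ultimately have "((\<lambda>y. if y \<in> {0..\<xi>} then A y \<xi> else A \<xi> \<xi> + (y - \<xi>) *\<^sub>R Ax \<xi> \<xi>)
      has_vector_derivative Bx x \<xi>) (at x within {0..1})"
    by simp
  then show "((\<lambda>y. B y \<xi>) has_vector_derivative Bx x \<xi>) (at x within {0..1})"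
    by (rule has_vector_derivative_transform[OF x, rotated]) (auto simp: B_def min_def)
qed

text \<open>
  For the extended kernel the two roles of \<open>x\<close> can be separated: as the argument of the kernel
  (differentiation under the integral) and as the lower limit (fundamental theorem of
  calculus).  The claim is the chain rule along the diagonal of these two variables.
\<close>

lemma volterra_integral_has_derivative_lower_limit:
  fixes A Ax :: "real \<Rightarrow> real \<Rightarrow> 'a::euclidean_space" and f :: "real \<Rightarrow> 'a"
  assumes A: "continuous_on tri (\<lambda>(x, \<xi>). A x \<xi>)" and Ax: "continuous_on tri (\<lambda>(x, \<xi>). Ax x \<xi>)"
    and dA: "\<And>x \<xi>. (x, \<xi>) \<in> tri \<Longrightarrow>
      ((\<lambda>y. A y \<xi>) has_vector_derivative Ax x \<xi>) (at x within {0..\<xi>})"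
    and f: "continuous_on {0..1} f" and x: "x \<in> {0..1}"
  shows "((\<lambda>y. integral {y..1} (\<lambda>\<xi>. A y \<xi> \<bullet> f \<xi>)) has_vector_derivative
    integral {x..1} (\<lambda>\<xi>. Ax x \<xi> \<bullet> f \<xi>) - A x x \<bullet> f x) (at x within {0..1})"
proof -
  obtain B Bx where B: "continuous_on ({0..1} \<times> {0..1}) (\<lambda>(x, \<xi>). B x \<xi>)"
    and Bx: "continuous_on ({0..1} \<times> {0..1}) (\<lambda>(x, \<xi>). Bx x \<xi>)"
    and dB: "\<And>x \<xi>. x \<in> {0..1} \<Longrightarrow> \<xi> \<in> {0..1} \<Longrightarrow>
      ((\<lambda>y. B y \<xi>) has_vector_derivative Bx x \<xi>) (at x within {0..1})"
    and BA: "\<And>x \<xi>. (x, \<xi>) \<in> tri \<Longrightarrow> B x \<xi> = A x \<xi>"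
    and BxAx: "\<And>x \<xi>. (x, \<xi>) \<in> tri \<Longrightarrow> Bx x \<xi> = Ax x \<xi>"
    by (rule extend_kernel_past_diagonal[OF A Ax dA]) (blast+)
  define h where "h y z = integral {z..1} (\<lambda>\<xi>. B y \<xi> \<bullet> f \<xi>)" for y z
  have cB: "continuous_on {0..1} (\<lambda>\<xi>. B y \<xi> \<bullet> f \<xi>)" if "y \<in> {0..1}" for y
    by (intro continuous_on_inner continuous_on_compose_pair[OF B] f continuous_intros) (use that in auto)
  have "((\<lambda>y. h y x) has_vector_derivative integral {x..1} (\<lambda>\<xi>. Bx x \<xi> \<bullet> f \<xi>)) (at x within {0..1})"
    unfolding h_def interval_cbox
  proof (rule leibniz_rule_vector_derivative)
    show "((\<lambda>y. B y \<xi> \<bullet> f \<xi>) has_vector_derivative Bx y \<xi> \<bullet> f \<xi>) (at y within cbox 0 1)"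
      if "y \<in> cbox 0 1" "\<xi> \<in> cbox x 1" for y \<xi>
      using bounded_linear.has_vector_derivative[OF bounded_linear_inner_left dB[of y \<xi>]] that x by simp
    show "(\<lambda>\<xi>. B y \<xi> \<bullet> f \<xi>) integrable_on cbox x 1" if "y \<in> cbox 0 1" for y
      using cB[of y] that x by (auto intro!: integrable_continuous_real elim: continuous_on_subset)
    show "continuous_on (cbox 0 1 \<times> cbox x 1) (\<lambda>(y, \<xi>). Bx y \<xi> \<bullet> f \<xi>)"
      unfolding case_prod_unfold
      by (intro continuous_on_inner continuous_on_compose_pair[OF Bx] continuous_on_compose2[OF f]
          continuous_intros) (use x in auto)
  qed (use x in auto)
  then have "((\<lambda>(y, z). h y z) has_derivative
      (\<lambda>(k, l). integral {x..1} (\<lambda>\<xi>. Bx x \<xi> \<bullet> f \<xi>) * k + - (B x x \<bullet> f x) * l))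
      (at (x, x) within {0..1} \<times> {0..1})"
  proof (rule has_derivative_rectangle[where ?f2.0 = "\<lambda>y z. - (B y z \<bullet> f z)", rotated 4])
    show "((\<lambda>z. h y z) has_vector_derivative - (B y z \<bullet> f z)) (at z within {0..1})"
      if "y \<in> {0..1}" "z \<in> {0..1}" for y z
      unfolding h_def by (rule integral_has_vector_derivative'[OF cB]) (use that in auto)
    show "continuous_on ({0..1} \<times> {0..1}) (\<lambda>(y, z). - (B y z \<bullet> f z))"
      unfolding case_prod_unfold
      by (intro continuous_on_minus continuous_on_inner continuous_on_compose_pair[OF B]
          continuous_on_compose2[OF f] continuous_intros) auto
  qed (use x in auto)
  then have "((\<lambda>(y, z). h y z) has_derivative
      (\<lambda>(k, l). integral {x..1} (\<lambda>\<xi>. Bx x \<xi> \<bullet> f \<xi>) * k + - (B x x \<bullet> f x) * l))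
      (at (x, x) within (\<lambda>y. (y, y)) ` {0..1})"
    by (rule has_derivative_subset) auto
  moreover have "((\<lambda>y. (y, y)) has_derivative (\<lambda>k. (k, k))) (at x within {0..1})"
    by (auto intro!: derivative_eq_intros)
  ultimately have "((\<lambda>y. h y y) has_vector_derivative
      (integral {x..1} (\<lambda>\<xi>. Bx x \<xi> \<bullet> f \<xi>) - B x x \<bullet> f x)) (at x within {0..1})"
    using diff_chain_within[of "\<lambda>y. (y, y)" "\<lambda>k. (k, k)" x "{0..1}" "\<lambda>(y, z). h y z"]
    by (fastforce simp: has_vector_derivative_def o_def algebra_simps)
  moreover have "integral {x..1} (\<lambda>\<xi>. Bx x \<xi> \<bullet> f \<xi>) = integral {x..1} (\<lambda>\<xi>. Ax x \<xi> \<bullet> f \<xi>)"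
    using x BxAx by (intro integral_cong) (auto simp: tri_def)
  moreover have "B x x = A x x"
    using x BA by (auto simp: tri_def)
  ultimately have "((\<lambda>y. h y y) has_vector_derivative
      (integral {x..1} (\<lambda>\<xi>. Ax x \<xi> \<bullet> f \<xi>) - A x x \<bullet> f x)) (at x within {0..1})"
    by simp
  then show ?thesis
  proof (rule has_vector_derivative_transform[OF x, rotated])
    show "integral {y..1} (\<lambda>\<xi>. A y \<xi> \<bullet> f \<xi>) = h y y" if "y \<in> {0..1}" for y
      unfolding h_def using that BA by (intro integral_cong) (auto simp: tri_def)
  qed
qed

text \<open>
  Total differentiability follows from the partial derivatives because these are again a sum of
  Volterra integrals and a continuous boundary term, hence jointly continuous.
\<close>

lemma C1_partials_volterra_integral:
  fixes A Ax f ft :: "real \<Rightarrow> real \<Rightarrow> 'a::euclidean_space"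
  assumes A: "continuous_on tri (\<lambda>(x, \<xi>). A x \<xi>)" and Ax: "continuous_on tri (\<lambda>(x, \<xi>). Ax x \<xi>)"
    and dA: "\<And>x \<xi>. (x, \<xi>) \<in> tri \<Longrightarrow>
      ((\<lambda>y. A y \<xi>) has_vector_derivative Ax x \<xi>) (at x within {0..\<xi>})"
    and f: "continuous_on time_space (\<lambda>(t, x). f t x)"
    and ft: "continuous_on time_space (\<lambda>(t, x). ft t x)"
    and df: "\<And>t x. t \<ge> 0 \<Longrightarrow> x \<in> {0..1} \<Longrightarrow>
      ((\<lambda>s. f s x) has_vector_derivative ft t x) (at t within {0..})"
  shows "C1_partials time_space (\<lambda>t x. integral {x..1} (\<lambda>\<xi>. A x \<xi> \<bullet> f t \<xi>))
    (\<lambda>t x. integral {x..1} (\<lambda>\<xi>. A x \<xi> \<bullet> ft t \<xi>))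
    (\<lambda>t x. integral {x..1} (\<lambda>\<xi>. Ax x \<xi> \<bullet> f t \<xi>) - A x x \<bullet> f t x)"
  unfolding time_space_def
proof (rule C1_partials_rectangleI, goal_cases)
  case 2
  then show ?case
    using continuous_on_volterra_integral[OF A ft] by (simp add: time_space_def)
next
  case 3
  have "continuous_on time_space (\<lambda>z. A (snd z) (snd z))"
    by (intro continuous_on_compose_pair[OF A] continuous_intros) (auto simp: tri_def time_space_def)
  then show ?case
    using continuous_on_volterra_integral[OF Ax f] f unfolding time_space_def case_prod_unfold
    by (intro continuous_on_diff continuous_on_inner)
next
  case (4 t x)
  show ?case
    unfolding interval_cbox
  proof (rule leibniz_rule_vector_derivative)
    show "((\<lambda>s. A x \<xi> \<bullet> f s \<xi>) has_vector_derivative A x \<xi> \<bullet> ft s \<xi>) (at s within {0..})"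
      if "s \<in> {0..}" "\<xi> \<in> cbox x 1" for s \<xi>
      using bounded_linear.has_vector_derivative[OF bounded_linear_inner_right df[of s \<xi>]] that 4 by simp
    show "(\<lambda>\<xi>. A x \<xi> \<bullet> f s \<xi>) integrable_on cbox x 1" if "s \<in> {0..}" for s
      unfolding cbox_interval
      by (intro integrable_continuous_real continuous_on_inner continuous_on_compose_pair[OF A]
          continuous_on_compose_pair[OF f] continuous_intros)
        (use that 4 in \<open>auto simp: tri_def time_space_def\<close>)
    show "continuous_on ({0..} \<times> cbox x 1) (\<lambda>(s, \<xi>). A x \<xi> \<bullet> ft s \<xi>)"
      unfolding case_prod_unfold
      by (intro continuous_on_inner continuous_on_compose_pair[OF A]
          continuous_on_compose_pair[OF ft] continuous_intros)
        (use 4 in \<open>auto simp: tri_def time_space_def\<close>)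
  qed (use 4 in auto)
next
  case (5 t x)
  then have "continuous_on {0..1} (f t)"
    by (intro continuous_on_compose_pair[OF f] continuous_intros) (auto simp: time_space_def)
  then show ?case
    by (intro volterra_integral_has_derivative_lower_limit[OF A Ax dA] 5)
qed auto

section \<open>Joint continuity of the vector kernels\<close>

text \<open>
  A Gronwall estimate from the right end point.  With \<open>k = 2 * C + 1\<close> the weighted energy
  \<open>exp (k * x) * ((norm (y x))\<^sup>2 + e\<^sup>2)\<close> is nondecreasing: by Cauchy-Schwarz
  \<open>- 2 * (y x \<bullet> D x) \<le> 2 * C * (norm (y x))\<^sup>2 + 2 * e * norm (y x)\<close>, and the last term is at most
  \<open>(norm (y x))\<^sup>2 + e\<^sup>2\<close>.  Keeping \<open>e\<^sup>2\<close> inside the energy absorbs the inhomogeneous part.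
\<close>

lemma gronwall_backward:
  fixes y D :: "real \<Rightarrow> 'a::real_inner"
  assumes "a \<le> b"
    and y: "\<And>x. x \<in> {a..b} \<Longrightarrow> (y has_vector_derivative D x) (at x within {a..b})"
    and D: "\<And>x. x \<in> {a..b} \<Longrightarrow> norm (D x) \<le> C * norm (y x) + e"
    and "0 \<le> C"
  shows "(norm (y a))\<^sup>2 + e\<^sup>2 \<le> exp ((2 * C + 1) * (b - a)) * ((norm (y b))\<^sup>2 + e\<^sup>2)"
proof -
  define k where "k = 2 * C + 1"
  define w where "w x = exp (k * x) * (y x \<bullet> y x + e\<^sup>2)" for x
  have cont: "continuous_on {a..b} y"
    unfolding continuous_on_eq_continuous_within using y has_vector_derivative_continuous by blast
  have "w a \<le> w b"
  proof (rule DERIV_nonneg_imp_increasing_open[OF \<open>a \<le> b\<close>])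
    show "continuous_on {a..b} w"
      unfolding w_def by (intro continuous_intros cont)
    fix x assume x: "a < x" "x < b"
    then have "(y has_vector_derivative D x) (at x)"
      using y[of x] at_within_Icc_at[OF x] by simp
    then have "(y has_derivative (\<lambda>h. h *\<^sub>R D x)) (at x)"
      by (simp add: has_vector_derivative_def)
    then have "(w has_derivative (\<lambda>h. (exp (k * x) * (k * (y x \<bullet> y x + e\<^sup>2) + 2 * (y x \<bullet> D x))) * h)) (at x)"
      unfolding w_def
      by (auto intro!: derivative_eq_intros simp: algebra_simps inner_commute)
    then have "(w has_real_derivative (exp (k * x) * (k * (y x \<bullet> y x + e\<^sup>2) + 2 * (y x \<bullet> D x)))) (at x)"
      by (simp add: has_field_derivative_def)
    moreover have "0 \<le> k * (y x \<bullet> y x + e\<^sup>2) + 2 * (y x \<bullet> D x)"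
    proof -
      have "- (y x \<bullet> D x) \<le> norm (y x) * norm (D x)"
        using Cauchy_Schwarz_ineq2[of "y x" "D x"] by linarith
      also have "\<dots> \<le> norm (y x) * (C * norm (y x) + e)"
        using D[of x] x by (intro mult_left_mono) auto
      also have "2 * \<dots> \<le> (2 * C + 1) * (norm (y x))\<^sup>2 + e\<^sup>2"
        using zero_le_power2[of "norm (y x) - e"] by (simp add: power2_eq_square algebra_simps)
      finally have "- 2 * (y x \<bullet> D x) \<le> k * (norm (y x))\<^sup>2 + e\<^sup>2"
        by (simp add: k_def)
      moreover have "e\<^sup>2 \<le> k * e\<^sup>2"
        using \<open>0 \<le> C\<close> mult_right_mono[of 1 k "e\<^sup>2"] by (simp add: k_def)
      ultimately show ?thesis
        by (simp add: power2_norm_eq_inner algebra_simps)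
    qed
    ultimately show "\<exists>d. (w has_real_derivative d) (at x) \<and> 0 \<le> d"
      by (intro exI[of _ "exp (k * x) * (k * (y x \<bullet> y x + e\<^sup>2) + 2 * (y x \<bullet> D x))"])
        (simp add: zero_le_mult_iff)
  qed
  then have "exp (- (k * a)) * w a \<le> exp (- (k * a)) * w b"
    by simp
  then show ?thesis
    unfolding w_def k_def[symmetric]
    by (simp add: power2_norm_eq_inner mult.assoc[symmetric] exp_add[symmetric] algebra_simps)
qed

text \<open>
  A family of linear initial value problems depends continuously on its parameter \<open>\<xi>\<close>.  The
  problems start at the diagonal, each at its own point, so two of them are compared after a
  shift that aligns the starting points: \<open>H (\<xi> - s) \<xi>\<close> and \<open>H (\<eta> - s) \<eta>\<close> agree at \<open>s = 0\<close>, and their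
  sources differ by little because \<open>b\<close> is uniformly continuous on the compact triangle.  The
  Gronwall estimate then makes them close for all \<open>s\<close>; a uniform Lipschitz bound along the sections
  handles points at different distances from the diagonal.
\<close>

lemma continuous_on_tri_of_section_ode:
  fixes H b :: "real \<Rightarrow> real \<Rightarrow> 'a::real_inner"
  assumes b: "continuous_on tri (\<lambda>(x, \<xi>). b x \<xi>)" and "bounded_linear M"
    and dH: "\<And>x \<xi>. (x, \<xi>) \<in> tri \<Longrightarrow>
      ((\<lambda>y. H y \<xi>) has_vector_derivative b x \<xi> + M (H x \<xi>)) (at x within {0..\<xi>})"
    and diag: "\<And>x. x \<in> {0..1} \<Longrightarrow> H x x = c"
  shows "continuous_on tri (\<lambda>(x, \<xi>). H x \<xi>)"
proof -
  interpret M: bounded_linear M by fact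
  obtain C where C: "C > 0" "\<And>g. norm (M g) \<le> norm g * C"
    using M.pos_bounded by blast
  have "compact tri"
  proof -
    have "closed {z :: real \<times> real. 0 \<le> fst z \<and> fst z \<le> snd z \<and> snd z \<le> 1}"
      by (intro closed_Collect_conj closed_Collect_le continuous_intros)
    moreover have "tri = {z. 0 \<le> fst z \<and> fst z \<le> snd z \<and> snd z \<le> 1}"
      by (auto simp: tri_def)
    ultimately have "closed tri"
      by simp
    moreover have "bounded tri"
      by (rule bounded_subset[of "cbox (0, 0) (1, 1)"]) (auto simp: tri_def)
    ultimately show ?thesis
      by (simp add: compact_eq_bounded_closed)
  qed
  then have "bounded ((\<lambda>(x, \<xi>). b x \<xi>) ` tri)" and unif: "uniformly_continuous_on tri (\<lambda>(x, \<xi>). b x \<xi>)"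
    using b by (auto intro: compact_imp_bounded compact_continuous_image compact_uniformly_continuous)
  then obtain \<beta> where \<beta>: "\<And>x \<xi>. (x, \<xi>) \<in> tri \<Longrightarrow> norm (b x \<xi>) \<le> \<beta>" "\<beta> > 0"
    by (fastforce simp: bounded_pos)
  define X where "X = exp (2 * C + 1)"
  have "1 \<le> X" unfolding X_def using C by simp
  have grow: "exp ((2 * C + 1) * (d - a)) \<le> X" if "0 \<le> a" "d \<le> 1" for a d
    unfolding X_def using that C mult_left_mono[of "d - a" 1 "2 * C + 1"] by simp
  define Y where "Y = sqrt (X * ((norm c)\<^sup>2 + \<beta>\<^sup>2))"
  \<comment> \<open>The zero function solves the homogeneous problem, and \<open>b\<close> is treated as a perturbation of it.\<close>
  have bound: "norm (H x \<xi>) \<le> Y" if "(x, \<xi>) \<in> tri" for x \<xi>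
  proof -
    have x: "0 \<le> x" "x \<le> \<xi>" "\<xi> \<le> 1" using that by (auto simp: tri_def)
    have "(norm (H x \<xi>))\<^sup>2 + \<beta>\<^sup>2 \<le> exp ((2 * C + 1) * (\<xi> - x)) * ((norm (H \<xi> \<xi>))\<^sup>2 + \<beta>\<^sup>2)"
    proof (rule gronwall_backward)
      fix y assume y: "y \<in> {x..\<xi>}"
      then have yt: "(y, \<xi>) \<in> tri" using x by (auto simp: tri_def)
      show "((\<lambda>y. H y \<xi>) has_vector_derivative b y \<xi> + M (H y \<xi>)) (at y within {x..\<xi>})"
        using has_vector_derivative_within_subset[OF dH[OF yt]] x by auto
      show "norm (b y \<xi> + M (H y \<xi>)) \<le> C * norm (H y \<xi>) + \<beta>"
        using norm_triangle_ineq[of "b y \<xi>" "M (H y \<xi>)"] C(2)[of "H y \<xi>"] \<beta>(1)[OF yt]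
        by (simp add: mult.commute)
    qed (use x C in auto)
    also have "\<dots> \<le> X * ((norm c)\<^sup>2 + \<beta>\<^sup>2)"
      using diag[of \<xi>] x grow[of x \<xi>] by (auto intro!: mult_right_mono)
    finally have "(norm (H x \<xi>))\<^sup>2 \<le> X * ((norm c)\<^sup>2 + \<beta>\<^sup>2)"
      by (smt (verit) zero_le_power2)
    then show ?thesis
      unfolding Y_def by (rule real_le_rsqrt)
  qed
  define Lip where "Lip = \<beta> + Y * C"
  have lip: "norm (H x \<xi> - H y \<xi>) \<le> Lip * \<bar>x - y\<bar>" if "(x, \<xi>) \<in> tri" "(y, \<xi>) \<in> tri" for x y \<xi>
  proof -
    have "norm (H x \<xi> - H y \<xi>) \<le> Lip * norm (x - y)"
    proof (rule differentiable_bound[of "{0..\<xi>}" "\<lambda>y. H y \<xi>" "\<lambda>y h. h *\<^sub>R (b y \<xi> + M (H y \<xi>))"])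
      fix z assume "z \<in> {0..\<xi>}"
      then have zt: "(z, \<xi>) \<in> tri" using that by (auto simp: tri_def)
      show "((\<lambda>y. H y \<xi>) has_derivative (\<lambda>h. h *\<^sub>R (b z \<xi> + M (H z \<xi>)))) (at z within {0..\<xi>})"
        using dH[OF zt] by (simp add: has_vector_derivative_def)
      have "norm (M (H z \<xi>)) \<le> Y * C"
        using C(2)[of "H z \<xi>"] mult_right_mono[OF bound[OF zt], of C] C(1) by linarith
      then have "norm (b z \<xi> + M (H z \<xi>)) \<le> Lip"
        using norm_triangle_ineq[of "b z \<xi>" "M (H z \<xi>)"] \<beta>(1)[OF zt] by (simp add: Lip_def)
      moreover from this have "0 \<le> Lip"
        using norm_ge_zero[of "b z \<xi> + M (H z \<xi>)"] by linarith
      ultimately show "onorm (\<lambda>h. h *\<^sub>R (b z \<xi> + M (H z \<xi>))) \<le> Lip"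
        by (intro onorm_bound) (auto simp: mult.commute[of Lip] intro!: mult_left_mono)
    qed (use that in \<open>auto simp: tri_def\<close>)
    then show ?thesis by simp
  qed
  have "Lip > 0"
    using \<beta> C \<open>1 \<le> X\<close> by (auto simp: Lip_def Y_def intro!: add_pos_nonneg)
  have diagonal: "norm (H (\<xi> - s) \<xi> - H (\<eta> - s) \<eta>) \<le> e * sqrt X"
    if s: "0 \<le> s" "s \<le> \<xi>" "s \<le> \<eta>" "\<xi> \<le> 1" "\<eta> \<le> 1" and "0 \<le> e"
      and e: "\<And>r. r \<in> {0..s} \<Longrightarrow> norm (b (\<xi> - r) \<xi> - b (\<eta> - r) \<eta>) \<le> e" for s \<xi> \<eta> e
  proof -
    have "(norm (H (\<xi> - s) \<xi> - H (\<xi> - s + (\<eta> - \<xi>)) \<eta>))\<^sup>2 + e\<^sup>2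
        \<le> exp ((2 * C + 1) * (\<xi> - (\<xi> - s))) * ((norm (H \<xi> \<xi> - H (\<xi> + (\<eta> - \<xi>)) \<eta>))\<^sup>2 + e\<^sup>2)"
    proof (rule gronwall_backward[where y = "\<lambda>y. H y \<xi> - H (y + (\<eta> - \<xi>)) \<eta>"])
      fix y assume y: "y \<in> {\<xi> - s..\<xi>}"
      let ?d = "\<eta> - \<xi>"
      let ?D1 = "b y \<xi> + M (H y \<xi>)" and ?D2 = "b (y + ?d) \<eta> + M (H (y + ?d) \<eta>)"
      have t: "(y, \<xi>) \<in> tri" "(y + ?d, \<eta>) \<in> tri"
        using y s by (auto simp: tri_def)
      have 1: "((\<lambda>y. H y \<xi>) has_vector_derivative ?D1) (at y within {\<xi> - s..\<xi>})"
        using has_vector_derivative_within_subset[OF dH[OF t(1)]] s by auto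
      have "((\<lambda>y. H y \<eta>) has_vector_derivative ?D2) (at (y + ?d) within (\<lambda>y. y + ?d) ` {\<xi> - s..\<xi>})"
        using has_vector_derivative_within_subset[OF dH[OF t(2)]] s by auto
      then have "(((\<lambda>y. H y \<eta>) \<circ> (\<lambda>y. y + ?d)) has_vector_derivative 1 *\<^sub>R ?D2) (at y within {\<xi> - s..\<xi>})"
        by (intro vector_diff_chain_within) (auto intro!: derivative_eq_intros)
      with 1 show "((\<lambda>y. H y \<xi> - H (y + ?d) \<eta>) has_vector_derivative ?D1 - ?D2) (at y within {\<xi> - s..\<xi>})"
        by (auto intro: has_vector_derivative_diff simp: o_def)
      have split: "?D1 - ?D2 = (b y \<xi> - b (y + ?d) \<eta>) + M (H y \<xi> - H (y + ?d) \<eta>)"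
        by (simp add: M.diff)
      have "norm (b y \<xi> - b (y + ?d) \<eta>) \<le> e"
        using e[of "\<xi> - y"] y by (simp add: algebra_simps)
      then show "norm (?D1 - ?D2) \<le> C * norm (H y \<xi> - H (y + ?d) \<eta>) + e"
        unfolding split
        using norm_triangle_ineq[of "b y \<xi> - b (y + ?d) \<eta>" "M (H y \<xi> - H (y + ?d) \<eta>)"]
          C(2)[of "H y \<xi> - H (y + ?d) \<eta>"] by (simp add: mult.commute)
    qed (use s C in auto)
    also have "\<dots> \<le> X * e\<^sup>2"
      using diag[of \<xi>] diag[of \<eta>] s grow[of "\<xi> - s" \<xi>] by (auto intro!: mult_right_mono)
    finally have "(norm (H (\<xi> - s) \<xi> - H (\<eta> - s) \<eta>))\<^sup>2 + e\<^sup>2 \<le> X * e\<^sup>2"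
      by simp
    then have "(norm (H (\<xi> - s) \<xi> - H (\<eta> - s) \<eta>))\<^sup>2 \<le> X * e\<^sup>2"
      using zero_le_power2[of e] by linarith
    then have "(norm (H (\<xi> - s) \<xi> - H (\<eta> - s) \<eta>))\<^sup>2 \<le> (e * sqrt X)\<^sup>2"
      using \<open>1 \<le> X\<close> by (simp add: power_mult_distrib mult.commute)
    then show ?thesis
      by (rule power2_le_imp_le) (use \<open>0 \<le> e\<close> \<open>1 \<le> X\<close> in simp)
  qed
  have "uniformly_continuous_on tri (\<lambda>(x, \<xi>). H x \<xi>)"
    unfolding uniformly_continuous_on_def
  proof (intro allI impI)
    fix e :: real assume "e > 0"
    define e1 where "e1 = e / 2 / sqrt X"
    have "e1 > 0" using \<open>e > 0\<close> \<open>1 \<le> X\<close> by (simp add: e1_def)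
    then obtain d where "d > 0"
      and d: "\<And>z w. z \<in> tri \<Longrightarrow> w \<in> tri \<Longrightarrow> dist w z < d \<Longrightarrow>
        dist ((\<lambda>(x, \<xi>). b x \<xi>) w) ((\<lambda>(x, \<xi>). b x \<xi>) z) < e1"
      using unif unfolding uniformly_continuous_on_def by metis
    define d' where "d' = min (d / 2) (e / (4 * Lip))"
    have "d' > 0" using \<open>d > 0\<close> \<open>e > 0\<close> \<open>Lip > 0\<close> by (simp add: d'_def)
    have "norm (H y \<eta> - H x \<xi>) < e" if t: "(x, \<xi>) \<in> tri" "(y, \<eta>) \<in> tri" and near: "dist (y, \<eta>) (x, \<xi>) < d'"
      for x \<xi> y \<eta>
    proof -
      have near': "\<bar>y - x\<bar> < d'" "\<bar>\<eta> - \<xi>\<bar> < d'"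
        using near dist_fst_le[of "(y, \<eta>)" "(x, \<xi>)"] dist_snd_le[of "(y, \<eta>)" "(x, \<xi>)"]
        by (auto simp: dist_real_def)
      \<comment> \<open>At distance \<open>s\<close> from the diagonal, both sections have a point between the diagonal and the given one.\<close>
      define s where "s = min (\<xi> - x) (\<eta> - y)"
      have s: "0 \<le> s" "s \<le> \<xi>" "s \<le> \<eta>" "\<xi> \<le> 1" "\<eta> \<le> 1"
        using t by (auto simp: s_def tri_def)
      have t': "(\<xi> - s, \<xi>) \<in> tri" "(\<eta> - s, \<eta>) \<in> tri"
        using s by (auto simp: tri_def)
      have "norm (H (\<xi> - s) \<xi> - H (\<eta> - s) \<eta>) \<le> e1 * sqrt X"
      proof (rule diagonal[OF s])
        fix r assume r: "r \<in> {0..s}"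
        have "dist (\<xi> - r, \<xi>) (\<eta> - r, \<eta>) \<le> \<bar>\<xi> - \<eta>\<bar> + \<bar>\<xi> - \<eta>\<bar>"
          using sqrt_sum_squares_le_sum_abs[of "\<xi> - \<eta>" "\<xi> - \<eta>"]
          by (simp add: dist_Pair_Pair dist_real_def)
        also have "\<dots> < d"
          using near'(2) by (simp add: d'_def abs_minus_commute[of \<xi>])
        finally show "norm (b (\<xi> - r) \<xi> - b (\<eta> - r) \<eta>) \<le> e1"
          using d[of "(\<eta> - r, \<eta>)" "(\<xi> - r, \<xi>)"] r s by (auto simp: tri_def dist_norm)
      qed (use \<open>e1 > 0\<close> in simp)
      then have 1: "norm (H (\<xi> - s) \<xi> - H (\<eta> - s) \<eta>) \<le> e / 2"
        using \<open>1 \<le> X\<close> by (simp add: e1_def)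
      have "norm (H x \<xi> - H (\<xi> - s) \<xi>) + norm (H (\<eta> - s) \<eta> - H y \<eta>)
          \<le> Lip * (\<bar>x - (\<xi> - s)\<bar> + \<bar>\<eta> - s - y\<bar>)"
        using lip[OF t(1) t'(1)] lip[OF t'(2) t(2)] by (simp add: algebra_simps)
      also have "\<bar>x - (\<xi> - s)\<bar> + \<bar>\<eta> - s - y\<bar> < 2 * d'"
        using near' by (auto simp: s_def min_def)
      then have "Lip * (\<bar>x - (\<xi> - s)\<bar> + \<bar>\<eta> - s - y\<bar>) < Lip * (2 * d')"
        using \<open>Lip > 0\<close> by simp
      also have "\<dots> \<le> Lip * (2 * (e / (4 * Lip)))"
        using \<open>Lip > 0\<close> by (intro mult_left_mono) (auto simp: d'_def)
      also have "\<dots> = e / 2"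
        using \<open>Lip > 0\<close> by simp
      finally have 2: "norm (H x \<xi> - H (\<xi> - s) \<xi>) + norm (H (\<eta> - s) \<eta> - H y \<eta>) < e / 2" .
      have "norm ((H x \<xi> - H (\<xi> - s) \<xi>) + (H (\<xi> - s) \<xi> - H (\<eta> - s) \<eta>) + (H (\<eta> - s) \<eta> - H y \<eta>))
          \<le> norm (H x \<xi> - H (\<xi> - s) \<xi>) + norm (H (\<xi> - s) \<xi> - H (\<eta> - s) \<eta>)
            + norm (H (\<eta> - s) \<eta> - H y \<eta>)"
        by (intro norm_triangle_le add_mono norm_triangle_ineq order_refl)
      then show ?thesis
        using 1 2 by (simp add: norm_minus_commute)
    qed
    then show "\<exists>d>0. \<forall>z\<in>tri. \<forall>w\<in>tri. dist w z < d \<longrightarrow>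
        dist ((\<lambda>(x, \<xi>). H x \<xi>) w) ((\<lambda>(x, \<xi>). H x \<xi>) z) < e"
      using \<open>d' > 0\<close> by (intro exI[of _ d']) (auto simp: dist_norm)
  qed
  then show ?thesis
    by (rule uniformly_continuous_imp_continuous)
qed

section \<open>The backstepping transformation\<close>

lemma integral_inner_by_parts:
  fixes f g f' g' :: "real \<Rightarrow> 'a::euclidean_space"
  assumes "a \<le> b"
    and f: "\<And>x. x \<in> {a..b} \<Longrightarrow> (f has_vector_derivative f' x) (at x within {a..b})"
    and g: "\<And>x. x \<in> {a..b} \<Longrightarrow> (g has_vector_derivative g' x) (at x within {a..b})"
    and f': "continuous_on {a..b} f'" and g': "continuous_on {a..b} g'"
  shows "integral {a..b} (\<lambda>x. f x \<bullet> g' x) = f b \<bullet> g b - f a \<bullet> g a - integral {a..b} (\<lambda>x. f' x \<bullet> g x)"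
proof -
  have fc: "continuous_on {a..b} f" and gc: "continuous_on {a..b} g"
    unfolding continuous_on_eq_continuous_within
    using f g has_vector_derivative_continuous by blast+
  have "((\<lambda>x. f x \<bullet> g' x + f' x \<bullet> g x) has_integral (f b \<bullet> g b - f a \<bullet> g a)) {a..b}"
    by (intro fundamental_theorem_of_calculus assms(1)
        bounded_bilinear.has_vector_derivative[OF bounded_bilinear_inner] f g)
  from integral_unique[OF this] show ?thesis
    using integral_add[OF integrable_continuous_real integrable_continuous_real,
        OF continuous_on_inner[OF fc g'] continuous_on_inner[OF f' gc]]
    by simp
qed

text \<open>
  The parameter \<open>c\<close> is the speed along which the transformed state is transported.  The kernels of
  \<open>\<alpha>\<close> satisfy the hypotheses with \<open>c = lam1\<close>, those of \<open>\<beta>\<close> with \<open>c = - lam2\<close>, so the cancellations are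
  carried out only once.  The combination \<open>Tt + c * Tx\<close> contains \<open>ux\<close> and \<open>px\<close> only through
  \<open>A * ux\<close> and \<open>B * px\<close>; after integration by parts, the coefficients of \<open>u\<close>, \<open>p\<close> and \<open>v\<close> under the integral are
  exactly the residuals of the three kernel equations.  The boundary terms at \<open>1\<close> cancel by the
  reflection condition, and only the diagonal terms are left.
\<close>

lemma volterra_transport_identity:
  fixes lam1 lam2 \<rho> \<sigma>12 \<sigma>21 c :: real
    and \<Theta>1 \<Theta>2 \<Omega>1 \<Omega>2 w0 :: "real ^ 'n" and \<Psi> :: "real ^ 'n ^ 'n"
    and C Cx v :: "real \<Rightarrow> real \<Rightarrow> real ^ 'n"
  assumes A: "C1_partials tri A Ax A\<xi>" and B: "C1_partials tri B Bx B\<xi>"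
    and "c \<noteq> 0"
    and dC: "\<And>x \<xi>. (x, \<xi>) \<in> tri \<Longrightarrow>
      ((\<lambda>y. C y \<xi>) has_vector_derivative Cx x \<xi>) (at x within {0..\<xi>})"
    and pdeA: "\<And>x \<xi>. (x, \<xi>) \<in> tri \<Longrightarrow>
      c * Ax x \<xi> + lam1 * A\<xi> x \<xi> = - \<sigma>21 * B x \<xi> - C x \<xi> \<bullet> \<Omega>1"
    and pdeB: "\<And>x \<xi>. (x, \<xi>) \<in> tri \<Longrightarrow>
      c * Bx x \<xi> - lam2 * B\<xi> x \<xi> = - \<sigma>12 * A x \<xi> - C x \<xi> \<bullet> \<Omega>2"
    and odeC: "\<And>x \<xi>. (x, \<xi>) \<in> tri \<Longrightarrow>
      c *\<^sub>R Cx x \<xi> = - (A x \<xi> *\<^sub>R \<Theta>1) - B x \<xi> *\<^sub>R \<Theta>2 - C x \<xi> v* \<Psi>"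
    and reflection: "\<And>x. x \<in> {0..1} \<Longrightarrow> lam1 * A x 1 = lam2 * \<rho> * B x 1"
    and diagC: "\<And>x. x \<in> {0..1} \<Longrightarrow> C x x = w0"
    and u: "C1_partials time_space u ut ux" and p: "C1_partials time_space p pt px"
    and v: "continuous_on time_space (\<lambda>(t, x). v t x)"
    and eq_u: "\<And>t x. t \<ge> 0 \<Longrightarrow> x \<in> {0..1} \<Longrightarrow>
      ut t x = - lam1 * ux t x + \<sigma>12 * p t x + \<Theta>1 \<bullet> v t x"
    and eq_v: "\<And>t x. t \<ge> 0 \<Longrightarrow> x \<in> {0..1} \<Longrightarrow>
      ((\<lambda>s. v s x) has_vector_derivative
        (u t x *\<^sub>R \<Omega>1 + p t x *\<^sub>R \<Omega>2 + \<Psi> *v v t x)) (at t within {0..})"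
    and eq_p: "\<And>t x. t \<ge> 0 \<Longrightarrow> x \<in> {0..1} \<Longrightarrow>
      pt t x = lam2 * px t x + \<sigma>21 * u t x + \<Theta>2 \<bullet> v t x"
    and bc: "\<And>t. t \<ge> 0 \<Longrightarrow> p t 1 = \<rho> * u t 1"
  obtains Tt Tx where
    "C1_partials time_space (\<lambda>t x. volterra A B C (u t) (p t) (v t) x) Tt Tx"
    "\<And>t x. t \<ge> 0 \<Longrightarrow> x \<in> {0..1} \<Longrightarrow> Tt t x + c * Tx t x =
      (lam1 - c) * A x x * u t x - (lam2 + c) * B x x * p t x - c * (C x x \<bullet> v t x)"
proof -
  define vt where "vt t x = u t x *\<^sub>R \<Omega>1 + p t x *\<^sub>R \<Omega>2 + \<Psi> *v v t x" for t x
  note Ac = C1_partials_imp_continuous_on[OF A] and Bc = C1_partials_imp_continuous_on[OF B]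
  note uc = C1_partials_imp_continuous_on[OF u] and pc = C1_partials_imp_continuous_on[OF p]
  have partials: "continuous_on tri (\<lambda>(x, \<xi>). Ax x \<xi>)" "continuous_on tri (\<lambda>(x, \<xi>). A\<xi> x \<xi>)"
    "continuous_on tri (\<lambda>(x, \<xi>). Bx x \<xi>)" "continuous_on tri (\<lambda>(x, \<xi>). B\<xi> x \<xi>)"
    "continuous_on time_space (\<lambda>(t, x). ut t x)" "continuous_on time_space (\<lambda>(t, x). ux t x)"
    "continuous_on time_space (\<lambda>(t, x). pt t x)" "continuous_on time_space (\<lambda>(t, x). px t x)"
    using A B u p unfolding C1_partials_def by blast+
  \<comment> \<open>Solved for the derivative, the equation for \<open>C\<close> is a linear ordinary differential equation on each section.\<close>
  have Cx_eq: "Cx x \<xi> = (1 / c) *\<^sub>R (- (A x \<xi> *\<^sub>R \<Theta>1) - B x \<xi> *\<^sub>R \<Theta>2) + (- (1 / c)) *\<^sub>R (C x \<xi> v* \<Psi>)"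
    if "(x, \<xi>) \<in> tri" for x \<xi>
  proof -
    have "Cx x \<xi> = (1 / c) *\<^sub>R (c *\<^sub>R Cx x \<xi>)"
      using \<open>c \<noteq> 0\<close> by simp
    then show ?thesis
      by (simp only: odeC[OF that]) (simp add: algebra_simps)
  qed
  have lin: "bounded_linear (\<lambda>g. (- (1 / c)) *\<^sub>R (g v* \<Psi>))"
    by (intro bounded_linear_const_scaleR linear_conv_bounded_linear[THEN iffD1])
      (simp add: matrix_vector_mul_linear flip: transpose_matrix_vector)
  have Cc: "continuous_on tri (\<lambda>(x, \<xi>). C x \<xi>)"
  proof (rule continuous_on_tri_of_section_ode[OF _ lin _ diagC])
    show "continuous_on tri (\<lambda>(x, \<xi>). (1 / c) *\<^sub>R (- (A x \<xi> *\<^sub>R \<Theta>1) - B x \<xi> *\<^sub>R \<Theta>2))"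
      using Ac Bc unfolding case_prod_unfold by (intro continuous_intros)
    show "((\<lambda>y. C y \<xi>) has_vector_derivative
        (1 / c) *\<^sub>R (- (A x \<xi> *\<^sub>R \<Theta>1) - B x \<xi> *\<^sub>R \<Theta>2) + (- (1 / c)) *\<^sub>R (C x \<xi> v* \<Psi>)) (at x within {0..\<xi>})"
      if "(x, \<xi>) \<in> tri" for x \<xi>
      using dC[OF that] Cx_eq[OF that] by simp
  qed
  have Cxc: "continuous_on tri (\<lambda>(x, \<xi>). Cx x \<xi>)"
  proof -
    have "continuous_on tri (\<lambda>z. (1 / c) *\<^sub>R (- (A (fst z) (snd z) *\<^sub>R \<Theta>1) - B (fst z) (snd z) *\<^sub>R \<Theta>2)
        + (- (1 / c)) *\<^sub>R (C (fst z) (snd z) v* \<Psi>))"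
      using Ac Bc Cc unfolding case_prod_unfold
      by (intro continuous_intros bounded_linear.continuous_on[OF lin])
    then show ?thesis
      by (rule continuous_on_eq) (auto simp: Cx_eq)
  qed
  have vtc: "continuous_on time_space (\<lambda>(t, x). vt t x)"
    using uc pc v unfolding vt_def case_prod_unfold
    by (intro continuous_intros bounded_linear.continuous_on[OF matrix_vector_mul_bounded_linear])
  have secA: "((\<lambda>y. A y \<xi>) has_vector_derivative Ax x \<xi>) (at x within {0..\<xi>})"
    and secB: "((\<lambda>y. B y \<xi>) has_vector_derivative Bx x \<xi>) (at x within {0..\<xi>})"
    if "(x, \<xi>) \<in> tri" for x \<xi>
    using that by (auto intro!: C1_partials_fst_section[OF A] C1_partials_fst_section[OF B] simp: tri_def)
  have du: "((\<lambda>s. u s x) has_vector_derivative ut t x) (at t within {0..})"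
    and dp: "((\<lambda>s. p s x) has_vector_derivative pt t x) (at t within {0..})"
    if "t \<ge> 0" "x \<in> {0..1}" for t x
    using that by (auto intro!: C1_partials_fst_section[OF u] C1_partials_fst_section[OF p] simp: time_space_def)
  define Tt where "Tt t x = integral {x..1} (\<lambda>\<xi>. A x \<xi> \<bullet> ut t \<xi>) + integral {x..1} (\<lambda>\<xi>. B x \<xi> \<bullet> pt t \<xi>)
    + integral {x..1} (\<lambda>\<xi>. C x \<xi> \<bullet> vt t \<xi>)" for t x
  define Tx where "Tx t x = (integral {x..1} (\<lambda>\<xi>. Ax x \<xi> \<bullet> u t \<xi>) - A x x \<bullet> u t x)
    + (integral {x..1} (\<lambda>\<xi>. Bx x \<xi> \<bullet> p t \<xi>) - B x x \<bullet> p t x)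
    + (integral {x..1} (\<lambda>\<xi>. Cx x \<xi> \<bullet> v t \<xi>) - C x x \<bullet> v t x)" for t x
  have "C1_partials time_space (\<lambda>t x. volterra A B C (u t) (p t) (v t) x) Tt Tx"
    unfolding volterra_def Tt_def Tx_def inner_real_def[symmetric]
    by (intro C1_partials_add C1_partials_volterra_integral Ac Bc Cc Cxc uc pc v vtc partials
        secA secB dC du dp eq_v[folded vt_def])
  moreover have "Tt t x + c * Tx t x =
      (lam1 - c) * A x x * u t x - (lam2 + c) * B x x * p t x - c * (C x x \<bullet> v t x)"
    if t: "t \<ge> 0" and x: "x \<in> {0..1}" for t x
  proof -
    let ?I = "integral {x..1}"
    have kc: "continuous_on {x..1} (k x)" if "continuous_on tri (\<lambda>(x, \<xi>). k x \<xi>)" for k :: "real \<Rightarrow> real \<Rightarrow> 'b::topological_space"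
      by (intro continuous_on_compose_pair[OF that] continuous_intros) (use x in \<open>auto simp: tri_def\<close>)
    have sc: "continuous_on {x..1} (f t)" if "continuous_on time_space (\<lambda>(t, x). f t x)" for f :: "real \<Rightarrow> real \<Rightarrow> 'b::topological_space"
      by (intro continuous_on_compose_pair[OF that] continuous_intros) (use x t in \<open>auto simp: time_space_def\<close>)
    note c = kc[OF Ac] kc[OF Bc] kc[OF Cc] kc[OF Cxc] kc[OF partials(1)] kc[OF partials(2)]
      kc[OF partials(3)] kc[OF partials(4)] sc[OF uc] sc[OF pc] sc[OF v] sc[OF vtc]
      sc[OF partials(5)] sc[OF partials(6)] sc[OF partials(7)] sc[OF partials(8)]
    note int = integrable_integral[OF integrable_continuous_real[OF continuous_on_inner]]
    have byA: "?I (\<lambda>\<xi>. A x \<xi> \<bullet> ux t \<xi>) = A x 1 \<bullet> u t 1 - A x x \<bullet> u t x - ?I (\<lambda>\<xi>. A\<xi> x \<xi> \<bullet> u t \<xi>)"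
      by (intro integral_inner_by_parts c C1_partials_snd_section[OF A] C1_partials_snd_section[OF u])
        (use x t in \<open>auto simp: tri_def time_space_def\<close>)
    have byB: "?I (\<lambda>\<xi>. B x \<xi> \<bullet> px t \<xi>) = B x 1 \<bullet> p t 1 - B x x \<bullet> p t x - ?I (\<lambda>\<xi>. B\<xi> x \<xi> \<bullet> p t \<xi>)"
      by (intro integral_inner_by_parts c C1_partials_snd_section[OF B] C1_partials_snd_section[OF p])
        (use x t in \<open>auto simp: tri_def time_space_def\<close>)
    \<comment> \<open>Adding back the diagonal terms of \<open>Tx\<close> leaves pure integrals on the left-hand side.\<close>
    have lhs: "((\<lambda>\<xi>. A x \<xi> \<bullet> ut t \<xi> + B x \<xi> \<bullet> pt t \<xi> + C x \<xi> \<bullet> vt t \<xi>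
        + c * (Ax x \<xi> \<bullet> u t \<xi> + Bx x \<xi> \<bullet> p t \<xi> + Cx x \<xi> \<bullet> v t \<xi>))
      has_integral Tt t x + c * (Tx t x + A x x \<bullet> u t x + B x x \<bullet> p t x + C x x \<bullet> v t x)) {x..1}"
      (is "(?L has_integral _) _")
      unfolding Tt_def Tx_def
      by (rule has_integral_eq_rhs)
        ((rule has_integral_add has_integral_mult_right int c)+, simp)
    \<comment> \<open>The integrand consists of derivatives of the products \<open>A * u\<close> and \<open>B * p\<close>.\<close>
    have rhs: "((\<lambda>\<xi>. - lam1 * (A x \<xi> \<bullet> ux t \<xi> + A\<xi> x \<xi> \<bullet> u t \<xi>)
        + lam2 * (B x \<xi> \<bullet> px t \<xi> + B\<xi> x \<xi> \<bullet> p t \<xi>))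
      has_integral - lam1 * (A x 1 \<bullet> u t 1 - A x x \<bullet> u t x) + lam2 * (B x 1 \<bullet> p t 1 - B x x \<bullet> p t x)) {x..1}"
      (is "(?R has_integral _) _")
      by (rule has_integral_eq_rhs)
        ((rule has_integral_add has_integral_mult_right int c)+, simp add: byA[unfolded inner_real_def] byB[unfolded inner_real_def])
    have "?L \<xi> = ?R \<xi>" if "\<xi> \<in> {x..1}" for \<xi>
    proof -
      have tr: "(x, \<xi>) \<in> tri" and \<xi>: "\<xi> \<in> {0..1}"
        using that x by (auto simp: tri_def)
      have "c * (Cx x \<xi> \<bullet> v t \<xi>) = (c *\<^sub>R Cx x \<xi>) \<bullet> v t \<xi>"
        by simp
      also have "\<dots> = - A x \<xi> * (\<Theta>1 \<bullet> v t \<xi>) - B x \<xi> * (\<Theta>2 \<bullet> v t \<xi>) - C x \<xi> \<bullet> (\<Psi> *v v t \<xi>)"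
        unfolding odeC[OF tr] by (simp add: inner_diff_left dot_lmul_matrix)
      finally have Cv: "c * (Cx x \<xi> \<bullet> v t \<xi>) = \<dots>" .
      have Au: "c * Ax x \<xi> = - lam1 * A\<xi> x \<xi> - \<sigma>21 * B x \<xi> - C x \<xi> \<bullet> \<Omega>1"
        using pdeA[OF tr] by simp
      have Bp: "c * Bx x \<xi> = lam2 * B\<xi> x \<xi> - \<sigma>12 * A x \<xi> - C x \<xi> \<bullet> \<Omega>2"
        using pdeB[OF tr] by simp
      have "?L \<xi> = A x \<xi> * ut t \<xi> + B x \<xi> * pt t \<xi> + C x \<xi> \<bullet> vt t \<xi>
          + (c * Ax x \<xi>) * u t \<xi> + (c * Bx x \<xi>) * p t \<xi> + c * (Cx x \<xi> \<bullet> v t \<xi>)"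
        by (simp add: algebra_simps)
      also have "\<dots> = ?R \<xi>"
        unfolding Cv Au Bp vt_def eq_u[OF t \<xi>] eq_p[OF t \<xi>]
        by (simp add: inner_add_right algebra_simps)
      finally show ?thesis .
    qed
    from has_integral_unique[OF has_integral_eq[OF this lhs] rhs]
    have "Tt t x + c * (Tx t x + A x x \<bullet> u t x + B x x \<bullet> p t x + C x x \<bullet> v t x)
        = - lam1 * (A x 1 \<bullet> u t 1 - A x x \<bullet> u t x) + lam2 * (B x 1 \<bullet> p t 1 - B x x \<bullet> p t x)"
      .
    moreover have "lam2 * (B x 1 * p t 1) = lam1 * (A x 1 * u t 1)"
    proof -
      have "lam2 * (B x 1 * p t 1) = (lam2 * \<rho> * B x 1) * u t 1"
        by (simp add: bc[OF t])
      then show ?thesis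
        unfolding reflection[OF x, symmetric] by simp
    qed
    ultimately show ?thesis
      by (simp add: algebra_simps)
  qed
  ultimately show thesis
    by (rule that)
qed

theorem lemma3p2:
  fixes lam1 lam2 \<rho> q \<sigma>12 \<sigma>21 :: real
    and \<Theta>1 \<Theta>2 \<Omega>1 \<Omega>2 :: "real ^ 'n"
    and \<Psi> :: "real ^ 'n ^ 'n"
    and K1 K2 Q1 Q2 L1 L2 M1 M2 :: "real \<Rightarrow> real \<Rightarrow> real"
    and G R S E :: "real \<Rightarrow> real \<Rightarrow> real ^ 'n"
    and U :: "real \<Rightarrow> real"
    and u p \<alpha> \<beta> :: "real \<Rightarrow> real \<Rightarrow> real"
    and v :: "real \<Rightarrow> real \<Rightarrow> real ^ 'n"
  assumes "lam1 > 0" and "lam2 > 0" and "\<rho> \<noteq> 0" and "q \<noteq> 0"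
    and "hurwitz \<Psi>"
    and "K_kernels lam1 lam2 \<rho> \<sigma>12 \<sigma>21 \<Theta>1 \<Theta>2 \<Omega>1 \<Omega>2 \<Psi> K1 K2 G"
    and "Q_kernels lam1 lam2 \<rho> \<sigma>12 \<sigma>21 \<Theta>1 \<Theta>2 \<Omega>1 \<Omega>2 \<Psi> Q1 Q2 R"
    and "inverse_kernels K1 K2 G Q1 Q2 R L1 L2 S M1 M2 E"
    and "plant_solution lam1 lam2 \<rho> q \<sigma>12 \<sigma>21 \<Theta>1 \<Theta>2 \<Omega>1 \<Omega>2 \<Psi> U u p v"
    and "\<And>t. t \<ge> 0 \<Longrightarrow> U t = - q * p t 0 + volterra K1 K2 G (u t) (p t) (v t) 0"
    and "\<And>t x. t \<ge> 0 \<Longrightarrow> x \<in> {0..1} \<Longrightarrow> \<alpha> t x = u t x - volterra K1 K2 G (u t) (p t) (v t) x"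
    and "\<And>t x. t \<ge> 0 \<Longrightarrow> x \<in> {0..1} \<Longrightarrow> \<beta> t x = p t x - volterra Q1 Q2 R (u t) (p t) (v t) x"
  shows "target_solution lam1 lam2 \<rho> \<Omega>1 \<Omega>2 \<Psi>
           (\<lambda>x \<xi>. L1 x \<xi> *\<^sub>R \<Omega>1 + M1 x \<xi> *\<^sub>R \<Omega>2)
           (\<lambda>x \<xi>. L2 x \<xi> *\<^sub>R \<Omega>1 + M2 x \<xi> *\<^sub>R \<Omega>2)
           (\<lambda>x \<xi>. outer \<Omega>1 (S x \<xi>) + outer \<Omega>2 (E x \<xi>))
           \<alpha> \<beta> v"
proof -
  let ?T = "\<lambda>t x. volterra K1 K2 G (u t) (p t) (v t) x"
  let ?W = "\<lambda>t x. volterra Q1 Q2 R (u t) (p t) (v t) x"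
  note lam = assms(1,2)
  obtain ut ux pt px where v: "continuous_on time_space (\<lambda>(t, x). v t x)"
    and u: "C1_partials time_space u ut ux" and p: "C1_partials time_space p pt px"
    and eq_u: "\<And>t x. t \<ge> 0 \<Longrightarrow> x \<in> {0..1} \<Longrightarrow>
      ut t x = - lam1 * ux t x + \<sigma>12 * p t x + \<Theta>1 \<bullet> v t x"
    and eq_v: "\<And>t x. t \<ge> 0 \<Longrightarrow> x \<in> {0..1} \<Longrightarrow>
      ((\<lambda>s. v s x) has_vector_derivative
        (u t x *\<^sub>R \<Omega>1 + p t x *\<^sub>R \<Omega>2 + \<Psi> *v v t x)) (at t within {0..})"
    and eq_p: "\<And>t x. t \<ge> 0 \<Longrightarrow> x \<in> {0..1} \<Longrightarrow>
      pt t x = lam2 * px t x + \<sigma>21 * u t x + \<Theta>2 \<bullet> v t x"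
    and bc: "\<And>t. t \<ge> 0 \<Longrightarrow> u t 0 = U t + q * p t 0" "\<And>t. t \<ge> 0 \<Longrightarrow> p t 1 = \<rho> * u t 1"
    using assms(9) unfolding plant_solution_def by blast
  obtain K1x K1\<xi> K2x K2\<xi> Gx where
    K: "C1_partials tri K1 K1x K1\<xi>" "C1_partials tri K2 K2x K2\<xi>"
      "\<And>x \<xi>. (x, \<xi>) \<in> tri \<Longrightarrow> ((\<lambda>y. G y \<xi>) has_vector_derivative Gx x \<xi>) (at x within {0..\<xi>})"
      "\<And>x \<xi>. (x, \<xi>) \<in> tri \<Longrightarrow> lam1 * K1x x \<xi> + lam1 * K1\<xi> x \<xi> = - \<sigma>21 * K2 x \<xi> - G x \<xi> \<bullet> \<Omega>1"
      "\<And>x \<xi>. (x, \<xi>) \<in> tri \<Longrightarrow> lam1 * K2x x \<xi> - lam2 * K2\<xi> x \<xi> = - \<sigma>12 * K1 x \<xi> - G x \<xi> \<bullet> \<Omega>2"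
      "\<And>x \<xi>. (x, \<xi>) \<in> tri \<Longrightarrow>
        lam1 *\<^sub>R Gx x \<xi> = - (K1 x \<xi> *\<^sub>R \<Theta>1) - K2 x \<xi> *\<^sub>R \<Theta>2 - G x \<xi> v* \<Psi>"
    and K_bc: "\<And>x. x \<in> {0..1} \<Longrightarrow> K1 x 1 = lam2 * \<rho> / lam1 * K2 x 1"
      "\<And>x. x \<in> {0..1} \<Longrightarrow> K2 x x = - \<sigma>12 / (lam1 + lam2)"
      "\<And>x. x \<in> {0..1} \<Longrightarrow> G x x = - ((1 / lam1) *\<^sub>R \<Theta>1)"
    using assms(6) unfolding K_kernels_def by blast
  obtain Q1x Q1\<xi> Q2x Q2\<xi> Rx where
    Q: "C1_partials tri Q1 Q1x Q1\<xi>" "C1_partials tri Q2 Q2x Q2\<xi>"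
      "\<And>x \<xi>. (x, \<xi>) \<in> tri \<Longrightarrow> ((\<lambda>y. R y \<xi>) has_vector_derivative Rx x \<xi>) (at x within {0..\<xi>})"
    and Q_eqs: "\<And>x \<xi>. (x, \<xi>) \<in> tri \<Longrightarrow> lam2 * Q1x x \<xi> - lam1 * Q1\<xi> x \<xi> = \<sigma>21 * Q2 x \<xi> + R x \<xi> \<bullet> \<Omega>1"
      "\<And>x \<xi>. (x, \<xi>) \<in> tri \<Longrightarrow> lam2 * Q2x x \<xi> + lam2 * Q2\<xi> x \<xi> = \<sigma>12 * Q1 x \<xi> + R x \<xi> \<bullet> \<Omega>2"
      "\<And>x \<xi>. (x, \<xi>) \<in> tri \<Longrightarrow>
        lam2 *\<^sub>R Rx x \<xi> = Q1 x \<xi> *\<^sub>R \<Theta>1 + Q2 x \<xi> *\<^sub>R \<Theta>2 + R x \<xi> v* \<Psi>"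
    and Q_bc: "\<And>x. x \<in> {0..1} \<Longrightarrow> Q1 x x = \<sigma>21 / (lam1 + lam2)"
      "\<And>x. x \<in> {0..1} \<Longrightarrow> Q2 x 1 = lam1 / (lam2 * \<rho>) * Q1 x 1"
      "\<And>x. x \<in> {0..1} \<Longrightarrow> R x x = (1 / lam2) *\<^sub>R \<Theta>2"
    using assms(7) unfolding Q_kernels_def by blast
  \<comment> \<open>Transport to the right at speed \<open>lam1\<close>; the coefficient of \<open>u\<close> on the diagonal vanishes.\<close>
  obtain Tt Tx where T: "C1_partials time_space ?T Tt Tx"
    and T_eq: "\<And>t x. t \<ge> 0 \<Longrightarrow> x \<in> {0..1} \<Longrightarrow> Tt t x + lam1 * Tx t x =
      (lam1 - lam1) * K1 x x * u t x - (lam2 + lam1) * K2 x x * p t x - lam1 * (G x x \<bullet> v t x)"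
  proof (rule volterra_transport_identity[OF K(1,2) _ K(3-6) _ K_bc(3) u p v eq_u eq_v eq_p bc(2)])
    show "lam1 * K1 x 1 = lam2 * \<rho> * K2 x 1" if "x \<in> {0..1}" for x
      using K_bc(1)[OF that] lam by simp
  qed (use lam in auto)
  \<comment> \<open>Transport to the left: speed \<open>- lam2\<close>; the coefficient of \<open>p\<close> on the diagonal vanishes.\<close>
  obtain Wt Wx where W: "C1_partials time_space ?W Wt Wx"
    and W_eq: "\<And>t x. t \<ge> 0 \<Longrightarrow> x \<in> {0..1} \<Longrightarrow> Wt t x + (- lam2) * Wx t x =
      (lam1 - (- lam2)) * Q1 x x * u t x - (lam2 + (- lam2)) * Q2 x x * p t x - (- lam2) * (R x x \<bullet> v t x)"
  proof (rule volterra_transport_identity[OF Q(1,2) _ Q(3) _ _ _ _ Q_bc(3) u p v eq_u eq_v eq_p bc(2)])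
    show "lam1 * Q1 x 1 = lam2 * \<rho> * Q2 x 1" if "x \<in> {0..1}" for x
      using Q_bc(2)[OF that] lam \<open>\<rho> \<noteq> 0\<close> by simp
    fix x \<xi> :: real assume tr: "(x, \<xi>) \<in> tri"
    show "- lam2 * Q1x x \<xi> + lam1 * Q1\<xi> x \<xi> = - \<sigma>21 * Q2 x \<xi> - R x \<xi> \<bullet> \<Omega>1"
      "- lam2 * Q2x x \<xi> - lam2 * Q2\<xi> x \<xi> = - \<sigma>12 * Q1 x \<xi> - R x \<xi> \<bullet> \<Omega>2"
      using Q_eqs(1,2)[OF tr] by simp_all
    show "(- lam2) *\<^sub>R Rx x \<xi> = - (Q1 x \<xi> *\<^sub>R \<Theta>1) - Q2 x \<xi> *\<^sub>R \<Theta>2 - R x \<xi> v* \<Psi>"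
      using Q_eqs(3)[OF tr] by simp
  qed (use lam in auto)
  have \<alpha>: "C1_partials time_space \<alpha> (\<lambda>t x. ut t x - Tt t x) (\<lambda>t x. ux t x - Tx t x)"
    by (rule C1_partials_transform[OF C1_partials_diff[OF u T]])
      (use assms(11) in \<open>auto simp: time_space_def\<close>)
  have \<beta>: "C1_partials time_space \<beta> (\<lambda>t x. pt t x - Wt t x) (\<lambda>t x. px t x - Wx t x)"
    by (rule C1_partials_transform[OF C1_partials_diff[OF p W]])
      (use assms(12) in \<open>auto simp: time_space_def\<close>)
  have transport: "ut t x - Tt t x = - lam1 * (ux t x - Tx t x)"
    "pt t x - Wt t x = lam2 * (px t x - Wx t x)" if t: "t \<ge> 0" and x: "x \<in> {0..1}" for t x
  proof -
    \<comment> \<open>The diagonal values of the kernels reproduce the coupling terms of the plant.\<close>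
    have "Tt t x + lam1 * Tx t x = \<sigma>12 * p t x + \<Theta>1 \<bullet> v t x"
      using T_eq[OF t x] lam by (simp add: K_bc(2,3)[OF x] add.commute)
    then show "ut t x - Tt t x = - lam1 * (ux t x - Tx t x)"
      using eq_u[OF t x] by (simp add: algebra_simps)
    have "Wt t x - lam2 * Wx t x = \<sigma>21 * u t x + \<Theta>2 \<bullet> v t x"
      using W_eq[OF t x] lam by (simp add: Q_bc(1,3)[OF x] add.commute)
    then show "pt t x - Wt t x = lam2 * (px t x - Wx t x)"
      using eq_p[OF t x] by (simp add: algebra_simps)
  qed
  have v_target: "((\<lambda>s. v s x) has_vector_derivative
      (\<alpha> t x *\<^sub>R \<Omega>1 + \<beta> t x *\<^sub>R \<Omega>2 + \<Psi> *v v t x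
       + integral {x..1} (\<lambda>\<xi>. \<alpha> t \<xi> *\<^sub>R (L1 x \<xi> *\<^sub>R \<Omega>1 + M1 x \<xi> *\<^sub>R \<Omega>2))
       + integral {x..1} (\<lambda>\<xi>. \<beta> t \<xi> *\<^sub>R (L2 x \<xi> *\<^sub>R \<Omega>1 + M2 x \<xi> *\<^sub>R \<Omega>2))
       + integral {x..1} (\<lambda>\<xi>. (outer \<Omega>1 (S x \<xi>) + outer \<Omega>2 (E x \<xi>)) *v v t \<xi>))) (at t within {0..})"
    if t: "t \<ge> 0" and x: "x \<in> {0..1}" for t x
  proof -
    have profile: "continuous_on {0..1} (f t)" if "continuous_on time_space (\<lambda>(t, x). f t x)"
      for f :: "real \<Rightarrow> real \<Rightarrow> 'b::topological_space"
      by (intro continuous_on_compose_pair[OF that] continuous_intros) (use t in \<open>auto simp: time_space_def\<close>)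
    have kernel_slice: "continuous_on {x..1} (k x)" if "continuous_on tri (\<lambda>(x, \<xi>). k x \<xi>)"
      for k :: "real \<Rightarrow> real \<Rightarrow> 'b::topological_space"
      by (intro continuous_on_compose_pair[OF that] continuous_intros) (use x in \<open>auto simp: tri_def\<close>)
    note \<alpha>c = continuous_on_subset[OF profile[OF C1_partials_imp_continuous_on[OF \<alpha>]], of "{x..1}"]
      and \<beta>c = continuous_on_subset[OF profile[OF C1_partials_imp_continuous_on[OF \<beta>]], of "{x..1}"]
      and vc = continuous_on_subset[OF profile[OF v], of "{x..1}"]
    have kernels: "continuous_on {x..1} (L1 x)" "continuous_on {x..1} (L2 x)" "continuous_on {x..1} (S x)"
      "continuous_on {x..1} (M1 x)" "continuous_on {x..1} (M2 x)" "continuous_on {x..1} (E x)"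
      using assms(8) unfolding inverse_kernels_def by (blast intro: kernel_slice)+
    have inverse: "u t x = \<alpha> t x + volterra L1 L2 S (\<alpha> t) (\<beta> t) (v t) x"
      "p t x = \<beta> t x + volterra M1 M2 E (\<alpha> t) (\<beta> t) (v t) x"
    proof -
      have "\<forall>x\<in>{0..1}. u t x = \<alpha> t x + volterra L1 L2 S (\<alpha> t) (\<beta> t) (v t) x \<and>
          p t x = \<beta> t x + volterra M1 M2 E (\<alpha> t) (\<beta> t) (v t) x"
        using assms(8) profile[OF C1_partials_imp_continuous_on[OF u]]
          profile[OF C1_partials_imp_continuous_on[OF p]] profile[OF v] assms(11,12) t
        unfolding inverse_kernels_def by blast
      with x show "u t x = \<alpha> t x + volterra L1 L2 S (\<alpha> t) (\<beta> t) (v t) x"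
        "p t x = \<beta> t x + volterra M1 M2 E (\<alpha> t) (\<beta> t) (v t) x" by blast+
    qed
    have split: "integral {x..1} (\<lambda>\<xi>. f \<xi> *\<^sub>R (k \<xi> *\<^sub>R \<Omega>1 + l \<xi> *\<^sub>R \<Omega>2))
        = integral {x..1} (\<lambda>\<xi>. k \<xi> * f \<xi>) *\<^sub>R \<Omega>1 + integral {x..1} (\<lambda>\<xi>. l \<xi> * f \<xi>) *\<^sub>R \<Omega>2"
      if "continuous_on {x..1} f" "continuous_on {x..1} k" "continuous_on {x..1} l" for f k l
    proof (rule integral_unique)
      have "((\<lambda>\<xi>. (k \<xi> * f \<xi>) *\<^sub>R \<Omega>1 + (l \<xi> * f \<xi>) *\<^sub>R \<Omega>2) has_integral
          integral {x..1} (\<lambda>\<xi>. k \<xi> * f \<xi>) *\<^sub>R \<Omega>1 + integral {x..1} (\<lambda>\<xi>. l \<xi> * f \<xi>) *\<^sub>R \<Omega>2) {x..1}"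
        by (intro has_integral_add has_integral_scaleR_left integrable_integral
            integrable_continuous_real continuous_on_mult that)
      then show "((\<lambda>\<xi>. f \<xi> *\<^sub>R (k \<xi> *\<^sub>R \<Omega>1 + l \<xi> *\<^sub>R \<Omega>2)) has_integral
          integral {x..1} (\<lambda>\<xi>. k \<xi> * f \<xi>) *\<^sub>R \<Omega>1 + integral {x..1} (\<lambda>\<xi>. l \<xi> * f \<xi>) *\<^sub>R \<Omega>2) {x..1}"
        by (simp add: scaleR_add_right mult.commute)
    qed
    have outer_mult: "outer w g *v z = (g \<bullet> z) *\<^sub>R w" for w g z :: "real ^ 'n"
      by (simp add: outer_def matrix_vector_mult_def inner_vec_def vec_eq_iff sum_distrib_left
          sum_distrib_right mult_ac)
    have "integral {x..1} (\<lambda>\<xi>. (outer \<Omega>1 (S x \<xi>) + outer \<Omega>2 (E x \<xi>)) *v v t \<xi>)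
        = integral {x..1} (\<lambda>\<xi>. S x \<xi> \<bullet> v t \<xi>) *\<^sub>R \<Omega>1 + integral {x..1} (\<lambda>\<xi>. E x \<xi> \<bullet> v t \<xi>) *\<^sub>R \<Omega>2"
      using split[of "\<lambda>_. 1" "\<lambda>\<xi>. S x \<xi> \<bullet> v t \<xi>" "\<lambda>\<xi>. E x \<xi> \<bullet> v t \<xi>"] kernels vc x
      by (simp add: matrix_vector_mult_add_rdistrib outer_mult continuous_on_inner)
    moreover have "integral {x..1} (\<lambda>\<xi>. \<alpha> t \<xi> *\<^sub>R (L1 x \<xi> *\<^sub>R \<Omega>1 + M1 x \<xi> *\<^sub>R \<Omega>2))
        = integral {x..1} (\<lambda>\<xi>. L1 x \<xi> * \<alpha> t \<xi>) *\<^sub>R \<Omega>1 + integral {x..1} (\<lambda>\<xi>. M1 x \<xi> * \<alpha> t \<xi>) *\<^sub>R \<Omega>2"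
      by (intro split \<alpha>c kernels) (use x in auto)
    moreover have "integral {x..1} (\<lambda>\<xi>. \<beta> t \<xi> *\<^sub>R (L2 x \<xi> *\<^sub>R \<Omega>1 + M2 x \<xi> *\<^sub>R \<Omega>2))
        = integral {x..1} (\<lambda>\<xi>. L2 x \<xi> * \<beta> t \<xi>) *\<^sub>R \<Omega>1 + integral {x..1} (\<lambda>\<xi>. M2 x \<xi> * \<beta> t \<xi>) *\<^sub>R \<Omega>2"
      by (intro split \<beta>c kernels) (use x in auto)
    ultimately have rhs_eq: "u t x *\<^sub>R \<Omega>1 + p t x *\<^sub>R \<Omega>2 + \<Psi> *v v t x =
       \<alpha> t x *\<^sub>R \<Omega>1 + \<beta> t x *\<^sub>R \<Omega>2 + \<Psi> *v v t x
       + integral {x..1} (\<lambda>\<xi>. \<alpha> t \<xi> *\<^sub>R (L1 x \<xi> *\<^sub>R \<Omega>1 + M1 x \<xi> *\<^sub>R \<Omega>2))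
       + integral {x..1} (\<lambda>\<xi>. \<beta> t \<xi> *\<^sub>R (L2 x \<xi> *\<^sub>R \<Omega>1 + M2 x \<xi> *\<^sub>R \<Omega>2))
       + integral {x..1} (\<lambda>\<xi>. (outer \<Omega>1 (S x \<xi>) + outer \<Omega>2 (E x \<xi>)) *v v t \<xi>)"
      by (simp only: inverse volterra_def) (simp add: scaleR_add_left)
    show ?thesis
      using eq_v[OF t x] unfolding rhs_eq .
  qed
  have "\<beta> t 1 = \<rho> * \<alpha> t 1 \<and> \<alpha> t 0 = 0" if t: "t \<ge> 0" for t
  proof
    show "\<beta> t 1 = \<rho> * \<alpha> t 1"
      using assms(11,12)[OF t, of 1] bc(2)[OF t] by (simp add: volterra_def)
    show "\<alpha> t 0 = 0"
      using assms(11)[OF t, of 0] assms(10)[OF t] bc(1)[OF t] by simp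
  qed
  then show ?thesis
    unfolding target_solution_def using v \<alpha> \<beta> transport v_target by blast
qed

end
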